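(* Let $\mathscr G$ be a Hausdorff ample groupoid, let $A=C_c(\mathscr G^{(0)})$ and let $\mathscr G^a$ be the inverse semigroup of compact open bisections of $\mathscr G$, acting on $A$ by the spectral action $\alpha_U:D_{U^{-1}}\to D_U$ ($U\in\mathscr G^a$), where $D_U=\{f\in A:\mathrm{supp}(f)\subseteq\boldsymbol r(U)\}$, $\alpha_U(f)(\boldsymbol r(\gamma))=f(\boldsymbol d(\gamma))$ for $\gamma\in U$, and $\alpha_U(f)$ vanishes outside $\boldsymbol r(U)$. Then $C_c(\mathscr G)$ is isomorphic as a ring to the skew inverse semigroup ring $A\rtimes\mathscr G^a$.
   Context: "Compact" includes Hausdorff. A groupoid $\mathscr G$ (identified with its set of arrows) has unit space $\mathscr G^{(0)}$, $\boldsymbol d(\gamma)=\gamma^{-1}\gamma$, $\boldsymbol r(\gamma)=\gamma\gamma^{-1}$. It is ample if it is a topological groupoid such that $\mathscr G^{(0)}$ is locally compact Hausdorff with a basis of compact open sets and $\boldsymbol r$ is a local homeomorphism. A bisection is a subset on which $\boldsymbol d$ and $\boldsymbol r$ are injective. The product and involution in $\mathscr G^a$ are $UV=\{uv:u\in U,v\in V,\boldsymbol d(u)=\boldsymbol r(v)\}$ and $U^*=U^{-1}$; the natural order is inclusion. $C_c(\mathscr G)$ is the complex span of the functions $f:\mathscr G\to\mathbb C$ for which there is a compact open bisection $U$ such that $f$ vanishes outside $U$ and $f|_U$ is continuous ($\mathbb C$ with its usual topology); it is a ring under pointwise addition and convolution $(f*g)(\gamma)=\sum_{\beta\rho=\gamma}f(\beta)g(\rho)$.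 $C_c(\mathscr G^{(0)})$ is the ring of compactly supported continuous functions $\mathscr G^{(0)}\to\mathbb C$ with pointwise operations. Skew inverse semigroup ring: for an action $\alpha$ of an inverse semigroup $S$ on a ring $A$ by isomorphisms $\alpha_s:D_{s^*}\to D_s$ between ideals of $A$ (each $D_s$ having local units), let $\mathcal L=\bigoplus_{s\in S}D_s\delta_s$ ($\delta_s$ formal symbols) with multiplication extending $(a\delta_s)(b\delta_t)=\alpha_s(\alpha_{s^*}(a)b)\delta_{st}$; let $\mathcal N$ be the ideal generated by all $a\delta_r-a\delta_s$ with $r\le s$ and $a\in D_r$. Then $A\rtimes S=\mathcal L/\mathcal N$. An action is spectral if $\sum_{e\in E(S)}D_e=A$ and each $D_e$, $e\in E(S)$, has a unit element. *)

theory Defs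
  imports "HOL-Analysis.Analysis" "HOL-Algebra.QuotRing" "HOL-Library.Function_Algebras"
begin

text \<open>
  Rings and semigroups need not have a unit element here. They are represented by the records
  of HOL-Algebra, whose field \<open>one\<close> is left unspecified and is not used by any of
  the definitions below. This gives access to finite sums, additive subgroups and the
  quotient \<open>R Quot I\<close>.
\<close>

section \<open>Rings not necessarily with unit\<close>

locale nonunital_ring = abelian_group R for R (structure) +
  assumes mult_closed: "\<lbrakk>x \<in> carrier R; y \<in> carrier R\<rbrakk> \<Longrightarrow> x \<otimes> y \<in> carrier R"
    and mult_assoc: "\<lbrakk>x \<in> carrier R; y \<in> carrier R; z \<in> carrier R\<rbrakk>
      \<Longrightarrow> (x \<otimes> y) \<otimes> z = x \<otimes> (y \<otimes> z)"
    and distrib_right: "\<lbrakk>x \<in> carrier R; y \<in> carrier R; z \<in> carrier R\<rbrakk>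
      \<Longrightarrow> (x \<oplus> y) \<otimes> z = x \<otimes> z \<oplus> y \<otimes> z"
    and distrib_left: "\<lbrakk>x \<in> carrier R; y \<in> carrier R; z \<in> carrier R\<rbrakk>
      \<Longrightarrow> z \<otimes> (x \<oplus> y) = z \<otimes> x \<oplus> z \<otimes> y"

text \<open>No associativity of the multiplication is assumed, since the ring
  \<open>\<L>\<close> below is not assumed to be associative a priori.\<close>

definition two_sided_ideal :: "'a set \<Rightarrow> ('a, 'm) ring_scheme \<Rightarrow> bool" where
  "two_sided_ideal I R \<longleftrightarrow> additive_subgroup I R \<and>
     (\<forall>a\<in>I. \<forall>x\<in>carrier R. x \<otimes>\<^bsub>R\<^esub> a \<in> I \<and> a \<otimes>\<^bsub>R\<^esub> x \<in> I)"

definition ideal_generated :: "('a, 'm) ring_scheme \<Rightarrow> 'a set \<Rightarrow> 'a set" where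
  "ideal_generated R X = \<Inter>{I. two_sided_ideal I R \<and> X \<subseteq> I}"

definition has_local_units :: "('a, 'm) ring_scheme \<Rightarrow> 'a set \<Rightarrow> bool" where
  "has_local_units R I \<longleftrightarrow> (\<forall>F. finite F \<and> F \<subseteq> I \<longrightarrow>
     (\<exists>e\<in>I. e \<otimes>\<^bsub>R\<^esub> e = e \<and> (\<forall>x\<in>F. e \<otimes>\<^bsub>R\<^esub> x = x \<and> x \<otimes>\<^bsub>R\<^esub> e = x)))"

definition has_unit_element :: "('a, 'm) ring_scheme \<Rightarrow> 'a set \<Rightarrow> bool" where
  "has_unit_element R I \<longleftrightarrow> (\<exists>u\<in>I. \<forall>x\<in>I. u \<otimes>\<^bsub>R\<^esub> x = x \<and> x \<otimes>\<^bsub>R\<^esub> u = x)"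

definition ring_isomorphic :: "('a, 'm) ring_scheme \<Rightarrow> ('b, 'n) ring_scheme \<Rightarrow> bool" where
  "ring_isomorphic R S \<longleftrightarrow> nonunital_ring R \<and> nonunital_ring S \<and>
     (\<exists>h. bij_betw h (carrier R) (carrier S) \<and>
        (\<forall>x\<in>carrier R. \<forall>y\<in>carrier R.
           h (x \<oplus>\<^bsub>R\<^esub> y) = h x \<oplus>\<^bsub>S\<^esub> h y \<and> h (x \<otimes>\<^bsub>R\<^esub> y) = h x \<otimes>\<^bsub>S\<^esub> h y))"

section \<open>Inverse semigroups and skew inverse semigroup rings\<close>

record 's inv_semigroup = "'s monoid" +
  star :: "'s \<Rightarrow> 's"

locale inverse_semigroup =
  fixes S :: "('s, 'm) inv_semigroup_scheme" (structure)
  assumes mult_closed: "\<lbrakk>x \<in> carrier S; y \<in> carrier S\<rbrakk> \<Longrightarrow> x \<otimes> y \<in> carrier S"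
    and mult_assoc: "\<lbrakk>x \<in> carrier S; y \<in> carrier S; z \<in> carrier S\<rbrakk>
      \<Longrightarrow> (x \<otimes> y) \<otimes> z = x \<otimes> (y \<otimes> z)"
    and star_closed: "x \<in> carrier S \<Longrightarrow> star S x \<in> carrier S"
    and unique_inverse: "\<lbrakk>x \<in> carrier S; y \<in> carrier S\<rbrakk>
      \<Longrightarrow> x \<otimes> y \<otimes> x = x \<and> y \<otimes> x \<otimes> y = y \<longleftrightarrow> y = star S x"

definition idempotents :: "('s, 'm) inv_semigroup_scheme \<Rightarrow> 's set" where
  "idempotents S = {e \<in> carrier S. e \<otimes>\<^bsub>S\<^esub> e = e}"

definition natural_le :: "('s, 'm) inv_semigroup_scheme \<Rightarrow> 's \<Rightarrow> 's \<Rightarrow> bool" where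
  "natural_le S s t \<longleftrightarrow> s \<in> carrier S \<and> t \<in> carrier S \<and> (\<exists>e\<in>idempotents S. s = t \<otimes>\<^bsub>S\<^esub> e)"

text \<open>An action is a homomorphism of \<open>S\<close> into the inverse semigroup of ring isomorphisms
  between ideals of \<open>A\<close>; \<open>\<alpha>\<^sub>s\<close> only matters on \<open>D\<^bsub>s\<^sup>*\<^esub>\<close>. In
  \<open>comp_domain\<close> the left-hand side is the domain of the composition
  \<open>\<alpha>\<^sub>s \<circ> \<alpha>\<^sub>t\<close> of partial maps.\<close>

locale inverse_semigroup_action = S: inverse_semigroup S + A: nonunital_ring A
  for S :: "('s, 'm) inv_semigroup_scheme" (structure)
    and A :: "('a, 'n) ring_scheme"
    and D :: "'s \<Rightarrow> 'a set"
    and \<alpha> :: "'s \<Rightarrow> 'a \<Rightarrow> 'a" +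
  assumes D_ideal: "s \<in> carrier S \<Longrightarrow> two_sided_ideal (D s) A"
    and D_local_units: "s \<in> carrier S \<Longrightarrow> has_local_units A (D s)"
    and \<alpha>_bij: "s \<in> carrier S \<Longrightarrow> bij_betw (\<alpha> s) (D (star S s)) (D s)"
    and \<alpha>_add: "\<lbrakk>s \<in> carrier S; a \<in> D (star S s); b \<in> D (star S s)\<rbrakk>
      \<Longrightarrow> \<alpha> s (a \<oplus>\<^bsub>A\<^esub> b) = \<alpha> s a \<oplus>\<^bsub>A\<^esub> \<alpha> s b"
    and \<alpha>_mult: "\<lbrakk>s \<in> carrier S; a \<in> D (star S s); b \<in> D (star S s)\<rbrakk>
      \<Longrightarrow> \<alpha> s (a \<otimes>\<^bsub>A\<^esub> b) = \<alpha> s a \<otimes>\<^bsub>A\<^esub> \<alpha> s b"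
    and comp_domain: "\<lbrakk>s \<in> carrier S; t \<in> carrier S\<rbrakk>
      \<Longrightarrow> {a \<in> D (star S t). \<alpha> t a \<in> D (star S s)} = D (star S (s \<otimes> t))"
    and comp_eq: "\<lbrakk>s \<in> carrier S; t \<in> carrier S; a \<in> D (star S (s \<otimes> t))\<rbrakk>
      \<Longrightarrow> \<alpha> (s \<otimes> t) a = \<alpha> s (\<alpha> t a)"

locale spectral_action = inverse_semigroup_action +
  assumes nondegenerate:
    "{\<Oplus>\<^bsub>A\<^esub>e\<in>F. x e | F x. finite F \<and> F \<subseteq> idempotents S \<and> x \<in> (\<Pi> e\<in>F. D e)} = carrier A"
    and unital: "e \<in> idempotents S \<Longrightarrow> has_unit_element A (D e)"

text \<open>The formal sum \<open>\<Sum>\<^sub>s a\<^sub>s \<delta>\<^sub>s\<close> is the finitely supported function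
  \<open>s \<mapsto> a\<^sub>s\<close>. The sum defining the coefficient at \<open>u\<close> of a product is
  restricted to the supports, so that its index set is finite (\<open>finsum\<close> over an infinite
  set is zero by convention).\<close>

definition skew_sum ::
  "('a, 'n) ring_scheme \<Rightarrow> ('s, 'm) inv_semigroup_scheme \<Rightarrow> ('s \<Rightarrow> 'a set) \<Rightarrow> ('s \<Rightarrow> 'a \<Rightarrow> 'a)
    \<Rightarrow> ('s \<Rightarrow> 'a) ring" where
  "skew_sum A S D \<alpha> =
     \<lparr>carrier = {\<phi>. (\<forall>s\<in>carrier S. \<phi> s \<in> D s) \<and> (\<forall>s. s \<notin> carrier S \<longrightarrow> \<phi> s = \<zero>\<^bsub>A\<^esub>) \<and>
                    finite {s. \<phi> s \<noteq> \<zero>\<^bsub>A\<^esub>}},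
      mult = (\<lambda>\<phi> \<psi> u. \<Oplus>\<^bsub>A\<^esub>p\<in>{(s, t). s \<in> carrier S \<and> t \<in> carrier S \<and> s \<otimes>\<^bsub>S\<^esub> t = u \<and>
                                   \<phi> s \<noteq> \<zero>\<^bsub>A\<^esub> \<and> \<psi> t \<noteq> \<zero>\<^bsub>A\<^esub>}.
                case p of (s, t) \<Rightarrow> \<alpha> s (\<alpha> (star S s) (\<phi> s) \<otimes>\<^bsub>A\<^esub> \<psi> t)),
      one = undefined,
      zero = (\<lambda>s. \<zero>\<^bsub>A\<^esub>),
      add = (\<lambda>\<phi> \<psi> s. \<phi> s \<oplus>\<^bsub>A\<^esub> \<psi> s)\<rparr>"

definition delta :: "('a, 'n) ring_scheme \<Rightarrow> 'a \<Rightarrow> 's \<Rightarrow> ('s \<Rightarrow> 'a)" where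
  "delta A a s = (\<lambda>t. if t = s then a else \<zero>\<^bsub>A\<^esub>)"

definition skew_relations ::
  "('a, 'n) ring_scheme \<Rightarrow> ('s, 'm) inv_semigroup_scheme \<Rightarrow> ('s \<Rightarrow> 'a set) \<Rightarrow> ('s \<Rightarrow> 'a \<Rightarrow> 'a)
    \<Rightarrow> ('s \<Rightarrow> 'a) set" where
  "skew_relations A S D \<alpha> = ideal_generated (skew_sum A S D \<alpha>)
     {delta A a r \<ominus>\<^bsub>skew_sum A S D \<alpha>\<^esub> delta A a s | a r s. natural_le S r s \<and> a \<in> D r}"

definition skew_ring ::
  "('a, 'n) ring_scheme \<Rightarrow> ('s, 'm) inv_semigroup_scheme \<Rightarrow> ('s \<Rightarrow> 'a set) \<Rightarrow> ('s \<Rightarrow> 'a \<Rightarrow> 'a)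
    \<Rightarrow> ('s \<Rightarrow> 'a) set ring" where
  "skew_ring A S D \<alpha> = skew_sum A S D \<alpha> Quot skew_relations A S D \<alpha>"

section \<open>Ample groupoids\<close>

text \<open>The arrows are the points of \<open>gtop G\<close>. The operations are total functions on the
  ambient type; \<open>gmult G x y\<close> is meaningful only for arrows with
  \<open>dom_map G x = ran_map G y\<close>.\<close>

record 'g groupoid_data =
  gtop :: "'g topology"
  gmult :: "'g \<Rightarrow> 'g \<Rightarrow> 'g"
  ginv :: "'g \<Rightarrow> 'g"

definition arrows :: "('g, 'm) groupoid_data_scheme \<Rightarrow> 'g set" where
  "arrows G = topspace (gtop G)"

definition dom_map :: "('g, 'm) groupoid_data_scheme \<Rightarrow> 'g \<Rightarrow> 'g" where
  "dom_map G x = gmult G (ginv G x) x"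

definition ran_map :: "('g, 'm) groupoid_data_scheme \<Rightarrow> 'g \<Rightarrow> 'g" where
  "ran_map G x = gmult G x (ginv G x)"

definition composable :: "('g, 'm) groupoid_data_scheme \<Rightarrow> ('g \<times> 'g) set" where
  "composable G = {(x, y). x \<in> arrows G \<and> y \<in> arrows G \<and> dom_map G x = ran_map G y}"

definition units :: "('g, 'm) groupoid_data_scheme \<Rightarrow> 'g set" where
  "units G = dom_map G ` arrows G"

definition unit_top :: "('g, 'm) groupoid_data_scheme \<Rightarrow> 'g topology" where
  "unit_top G = subtopology (gtop G) (units G)"

locale groupoid =
  fixes G :: "('g, 'm) groupoid_data_scheme"
  assumes inv_closed: "x \<in> arrows G \<Longrightarrow> ginv G x \<in> arrows G"
    and inv_inv: "x \<in> arrows G \<Longrightarrow> ginv G (ginv G x) = x"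
    and mult_closed: "(x, y) \<in> composable G \<Longrightarrow> gmult G x y \<in> arrows G"
    and dom_mult: "(x, y) \<in> composable G \<Longrightarrow> dom_map G (gmult G x y) = dom_map G y"
    and ran_mult: "(x, y) \<in> composable G \<Longrightarrow> ran_map G (gmult G x y) = ran_map G x"
    and assoc: "\<lbrakk>(x, y) \<in> composable G; (y, z) \<in> composable G\<rbrakk>
      \<Longrightarrow> gmult G (gmult G x y) z = gmult G x (gmult G y z)"
    and mult_dom: "x \<in> arrows G \<Longrightarrow> gmult G x (dom_map G x) = x"
    and ran_mult_self: "x \<in> arrows G \<Longrightarrow> gmult G (ran_map G x) x = x"

locale topological_groupoid = groupoid +
  assumes continuous_inv: "continuous_map (gtop G) (gtop G) (ginv G)"
    and continuous_mult:
      "continuous_map (subtopology (prod_topology (gtop G) (gtop G)) (composable G)) (gtop G)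
         (\<lambda>(x, y). gmult G x y)"

definition local_homeomorphism :: "'a topology \<Rightarrow> 'b topology \<Rightarrow> ('a \<Rightarrow> 'b) \<Rightarrow> bool" where
  "local_homeomorphism X Y f \<longleftrightarrow> f \<in> topspace X \<rightarrow> topspace Y \<and>
     (\<forall>x\<in>topspace X. \<exists>U. openin X U \<and> x \<in> U \<and> openin Y (f ` U) \<and>
        homeomorphic_map (subtopology X U) (subtopology Y (f ` U)) f)"

locale ample_groupoid = topological_groupoid +
  assumes units_locally_compact: "locally_compact_space (unit_top G)"
    and units_Hausdorff: "Hausdorff_space (unit_top G)"
    and units_compact_open_basis:
      "neighbourhood_base_of (\<lambda>K. compactin (unit_top G) K \<and> openin (unit_top G) K) (unit_top G)"
    and ran_local_homeomorphism: "local_homeomorphism (gtop G) (unit_top G) (ran_map G)"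

definition bisection :: "('g, 'm) groupoid_data_scheme \<Rightarrow> 'g set \<Rightarrow> bool" where
  "bisection G U \<longleftrightarrow> U \<subseteq> arrows G \<and> inj_on (dom_map G) U \<and> inj_on (ran_map G) U"

text \<open>Compactness includes the Hausdorff property.\<close>

definition compact_open_bisections :: "('g, 'm) groupoid_data_scheme \<Rightarrow> 'g set set" where
  "compact_open_bisections G =
     {U. bisection G U \<and> openin (gtop G) U \<and>
         compactin (gtop G) U \<and> Hausdorff_space (subtopology (gtop G) U)}"

definition bisection_semigroup :: "('g, 'm) groupoid_data_scheme \<Rightarrow> 'g set inv_semigroup" where
  "bisection_semigroup G =
     \<lparr>carrier = compact_open_bisections G,
      mult = (\<lambda>U V. {gmult G u v | u v. u \<in> U \<and> v \<in> V \<and> dom_map G u = ran_map G v}),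
      one = undefined,
      star = (\<lambda>U. ginv G ` U)\<rparr>"

section \<open>The rings of functions\<close>

text \<open>Functions on the arrows or on the units are represented by functions on the whole
  ambient type that vanish elsewhere; \<open>module.span\<close> is the complex linear span.
  In the convolution the sum is restricted to the supports of the two factors, so that its index
  set is finite (\<open>sum\<close> over an infinite set is zero by convention).\<close>

definition groupoid_functions :: "('g, 'm) groupoid_data_scheme \<Rightarrow> ('g \<Rightarrow> complex) set" where
  "groupoid_functions G = module.span (\<lambda>c f \<gamma>. c * f \<gamma>)
     {f. \<exists>U\<in>compact_open_bisections G. (\<forall>\<gamma>. \<gamma> \<notin> U \<longrightarrow> f \<gamma> = 0) \<and>
           continuous_map (subtopology (gtop G) U) euclidean f}"

definition convolution ::
  "('g, 'm) groupoid_data_scheme \<Rightarrow> ('g \<Rightarrow> complex) \<Rightarrow> ('g \<Rightarrow> complex) \<Rightarrow> 'g \<Rightarrow> complex" where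
  "convolution G f g \<gamma> =
     (\<Sum>(\<beta>, \<rho>) | (\<beta>, \<rho>) \<in> composable G \<and> gmult G \<beta> \<rho> = \<gamma> \<and> f \<beta> \<noteq> 0 \<and> g \<rho> \<noteq> 0. f \<beta> * g \<rho>)"

definition Cc_groupoid :: "('g, 'm) groupoid_data_scheme \<Rightarrow> ('g \<Rightarrow> complex) ring" where
  "Cc_groupoid G =
     \<lparr>carrier = groupoid_functions G,
      mult = convolution G,
      one = undefined,
      zero = (\<lambda>\<gamma>. 0),
      add = (\<lambda>f g \<gamma>. f \<gamma> + g \<gamma>)\<rparr>"

definition unit_support :: "('g, 'm) groupoid_data_scheme \<Rightarrow> ('g \<Rightarrow> complex) \<Rightarrow> 'g set" where
  "unit_support G f = unit_top G closure_of {x \<in> units G. f x \<noteq> 0}"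

definition Cc_units :: "('g, 'm) groupoid_data_scheme \<Rightarrow> ('g \<Rightarrow> complex) ring" where
  "Cc_units G =
     \<lparr>carrier = {f. (\<forall>x. x \<notin> units G \<longrightarrow> f x = 0) \<and> continuous_map (unit_top G) euclidean f \<and>
                    compactin (unit_top G) (unit_support G f)},
      mult = (\<lambda>f g x. f x * g x),
      one = undefined,
      zero = (\<lambda>x. 0),
      add = (\<lambda>f g x. f x + g x)\<rparr>"

definition bisection_ideal ::
  "('g, 'm) groupoid_data_scheme \<Rightarrow> 'g set \<Rightarrow> ('g \<Rightarrow> complex) set" where
  "bisection_ideal G U = {f \<in> carrier (Cc_units G). unit_support G f \<subseteq> ran_map G ` U}"

definition bisection_action ::
  "('g, 'm) groupoid_data_scheme \<Rightarrow> 'g set \<Rightarrow> ('g \<Rightarrow> complex) \<Rightarrow> 'g \<Rightarrow> complex" where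
  "bisection_action G U f x =
     (if x \<in> ran_map G ` U then f (dom_map G (inv_into U (ran_map G) x)) else 0)"

end

theory Submission
  imports Defs
begin

text \<open>
  The homomorphism \<open>skew_hom\<close> from the direct sum \<open>\<L>\<close> to the functions on the groupoid sends
  \<open>a \<delta>\<^sub>U\<close> to \<open>a \<circ> r\<close> on \<open>U\<close>, extended by zero. It is surjective because \<open>r\<close> restricts to a
  homeomorphism on a compact open bisection, and it kills the relations. Conversely, let
  \<open>\<Sum> a\<^sub>i \<delta>\<^bsub>U\<^sub>i\<^esub>\<close> be in its kernel. Then \<open>a\<^sub>n \<circ> r\<close> vanishes on the part of \<open>U\<^sub>n\<close> outside the
  other \<open>U\<^sub>i\<close>. Intersections of compact open sets are compact open in a Hausdorff space, so
  modulo the relations \<open>a\<^sub>n \<delta>\<^bsub>U\<^sub>n\<^esub>\<close> can be cut into pieces supported in the \<open>U\<^sub>n \<inter> U\<^sub>i\<close>,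
  which are absorbed into the other terms. By induction on the number of terms the sum is zero
  modulo the relations.
\<close>

section \<open>Algebra of groupoids and bisections\<close>

text \<open>Associativity of the skew sum \<open>L\<close>, and hence of its quotient, is not known
  beforehand. The quotient receives its ring axioms from \<open>C\<close>, transported along the
  bijection that sends a function to its fibre under \<open>skew_hom\<close>. The axioms of
  \<open>C\<close> are therefore proved directly: convolution is associative and distributive on all
  functions with finite support in each range fibre, a purely algebraic condition, and closure under
  convolution is read off from the image of \<open>L\<close>. On the topological side everything
  rests on the range of a compact open bisection being clopen in the unit space. Then
  \<open>D U\<close> consists of the continuous functions vanishing off that range, extension by
  zero is continuous, and the indicator \<open>chi U\<close> belongs to \<open>D U\<close>. It is
  the unit of \<open>D U\<close>, and it also does the cutting in the kernel argument. The relations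
  compare only nested bisections, so overlapping \<open>U\<close> and \<open>V\<close> can be
  compared only through \<open>U \<inter> V\<close>. This must again be a compact open bisection,
  which is where Hausdorffness of the whole arrow space enters the kernel argument.\<close>

context groupoid
begin

abbreviation d where "d \<equiv> dom_map G"
abbreviation r where "r \<equiv> ran_map G"
abbreviation gm (infixl "\<cdot>" 70) where "x \<cdot> y \<equiv> gmult G x y"
abbreviation iv where "iv \<equiv> ginv G"

lemma d_inv: "x \<in> arrows G \<Longrightarrow> d (iv x) = r x"
  by (simp add: dom_map_def ran_map_def inv_inv)

lemma r_inv: "x \<in> arrows G \<Longrightarrow> r (iv x) = d x"
  by (simp add: dom_map_def ran_map_def inv_inv)

lemma composableI: "x \<in> arrows G \<Longrightarrow> y \<in> arrows G \<Longrightarrow> d x = r y \<Longrightarrow> (x, y) \<in> composable G"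
  by (simp add: composable_def)

lemma mult_closed': "x \<in> arrows G \<Longrightarrow> y \<in> arrows G \<Longrightarrow> d x = r y \<Longrightarrow> x \<cdot> y \<in> arrows G"
  by (simp add: composableI mult_closed)

lemma d_mult: "x \<in> arrows G \<Longrightarrow> y \<in> arrows G \<Longrightarrow> d x = r y \<Longrightarrow> d (x \<cdot> y) = d y"
  by (simp add: composableI dom_mult)

lemma r_mult: "x \<in> arrows G \<Longrightarrow> y \<in> arrows G \<Longrightarrow> d x = r y \<Longrightarrow> r (x \<cdot> y) = r x"
  by (simp add: composableI ran_mult)

lemma mult_assoc': "x \<in> arrows G \<Longrightarrow> y \<in> arrows G \<Longrightarrow> z \<in> arrows G \<Longrightarrow> d x = r y \<Longrightarrow> d y = r z
    \<Longrightarrow> (x \<cdot> y) \<cdot> z = x \<cdot> (y \<cdot> z)"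
  by (simp add: composableI assoc)

lemma d_closed: "x \<in> arrows G \<Longrightarrow> d x \<in> arrows G"
  using mult_closed'[of "iv x" x] d_inv[of x] inv_closed[of x] by (simp add: dom_map_def)

lemma r_closed: "x \<in> arrows G \<Longrightarrow> r x \<in> arrows G"
  using d_closed[of "iv x"] by (simp add: d_inv inv_closed)

lemma d_d: "x \<in> arrows G \<Longrightarrow> d (d x) = d x"
  using d_mult[of "iv x" x] d_inv[of x] inv_closed[of x] by (simp add: dom_map_def)

lemma r_d: "x \<in> arrows G \<Longrightarrow> r (d x) = d x"
  using r_mult[of "iv x" x] r_inv[of x] d_inv[of x] inv_closed[of x] by (simp add: dom_map_def)

lemma r_r: "x \<in> arrows G \<Longrightarrow> r (r x) = r x"
  using r_d[of "iv x"] by (simp add: d_inv inv_closed)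

lemma inv_mult_self: "iv x \<cdot> x = d x"
  by (simp add: dom_map_def)

lemma mult_inv_self: "x \<cdot> iv x = r x"
  by (simp add: ran_map_def)

lemma inv_cancel: "x \<in> arrows G \<Longrightarrow> y \<in> arrows G \<Longrightarrow> d x = r y \<Longrightarrow> iv x \<cdot> (x \<cdot> y) = y"
  using mult_assoc'[of "iv x" x y] ran_mult_self[of y]
  by (simp add: inv_mult_self d_inv inv_closed)

lemma cancel_inv: "x \<in> arrows G \<Longrightarrow> y \<in> arrows G \<Longrightarrow> r x = r y \<Longrightarrow> x \<cdot> (iv x \<cdot> y) = y"
  using inv_cancel[of "iv x" y] by (simp add: d_inv inv_inv inv_closed)

text \<open>Cancelling \<open>x\<close> on the left turns the last hypothesis into
  \<open>y \<cdot> x = d x\<close>; multiplying by \<open>iv x\<close> on the right isolates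
  \<open>y\<close>.\<close>

lemma inv_unique:
  assumes "x \<in> arrows G" "y \<in> arrows G" "d x = r y" "d y = r x" "(x \<cdot> y) \<cdot> x = x"
  shows "y = iv x"
proof -
  have "x \<cdot> (y \<cdot> x) = x" using assms by (simp add: mult_assoc')
  then have "iv x \<cdot> x = y \<cdot> x"
    using inv_cancel[of x "y \<cdot> x"] assms by (simp add: mult_closed' r_mult)
  then have "(y \<cdot> x) \<cdot> iv x = d x \<cdot> iv x" by (simp add: inv_mult_self)
  moreover have "(y \<cdot> x) \<cdot> iv x = y \<cdot> r x"
    using assms by (simp add: mult_assoc' inv_closed r_inv mult_inv_self)
  moreover have "d x \<cdot> iv x = iv x" using ran_mult_self[of "iv x"] assms by (simp add: inv_closed r_inv)
  moreover have "y \<cdot> r x = y" using mult_dom[of y] assms by simp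
  ultimately show ?thesis by simp
qed

lemma units_arrows: "x \<in> units G \<Longrightarrow> x \<in> arrows G"
  by (auto simp: units_def d_closed)

lemma units_d: "x \<in> units G \<Longrightarrow> d x = x"
  by (auto simp: units_def d_d)

lemma units_r: "x \<in> units G \<Longrightarrow> r x = x"
  by (auto simp: units_def r_d)

lemma d_units: "x \<in> arrows G \<Longrightarrow> d x \<in> units G"
  by (auto simp: units_def)

lemma r_units: "x \<in> arrows G \<Longrightarrow> r x \<in> units G"
  using d_units[of "iv x"] by (simp add: d_inv inv_closed)

lemma units_iff: "x \<in> units G \<longleftrightarrow> x \<in> arrows G \<and> r x = x"
  using r_units by (metis units_arrows units_r)

lemma idempotent_unit:
  assumes "x \<in> arrows G" "d x = r x" "x \<cdot> x = x"
  shows "x \<in> units G"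
proof -
  \<comment> \<open>Cancellation evaluates this product to \<open>x\<close>, whereas idempotency
    evaluates it to \<open>d x\<close>.\<close>
  have "iv x \<cdot> (x \<cdot> x) = x" using assms by (intro inv_cancel) auto
  then show ?thesis using assms d_units by (simp add: inv_mult_self units_iff)
qed

section \<open>Products of sets of arrows and of bisections\<close>

definition setmult (infixl "\<odot>" 70) where
  "U \<odot> V = {u \<cdot> v | u v. u \<in> U \<and> v \<in> V \<and> d u = r v}"

lemma bisection_arrows: "bisection G U \<Longrightarrow> u \<in> U \<Longrightarrow> u \<in> arrows G"
  by (auto simp: bisection_def)

lemma bisection_r_eq: "bisection G U \<Longrightarrow> u \<in> U \<Longrightarrow> v \<in> U \<Longrightarrow> r u = r v \<Longrightarrow> u = v"
  by (auto simp: bisection_def dest: inj_onD)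

lemma bisection_d_eq: "bisection G U \<Longrightarrow> u \<in> U \<Longrightarrow> v \<in> U \<Longrightarrow> d u = d v \<Longrightarrow> u = v"
  by (auto simp: bisection_def dest: inj_onD)

lemma setmultI: "u \<in> U \<Longrightarrow> v \<in> V \<Longrightarrow> d u = r v \<Longrightarrow> u \<cdot> v \<in> U \<odot> V"
  by (auto simp: setmult_def)

lemma setmultE:
  assumes "x \<in> U \<odot> V" "U \<subseteq> arrows G" "V \<subseteq> arrows G"
  obtains u v where "u \<in> U" "v \<in> V" "d u = r v" "x = u \<cdot> v" "r x = r u" "d x = d v"
    "u \<in> arrows G" "v \<in> arrows G" "x \<in> arrows G"
  using assms unfolding setmult_def by (auto simp: r_mult d_mult mult_closed' subset_iff)

lemma setmultD:
  assumes "x \<in> U \<odot> V" "U \<subseteq> arrows G" "V \<subseteq> arrows G"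
  shows "\<exists>u v. u \<in> U \<and> v \<in> V \<and> d u = r v \<and> x = u \<cdot> v \<and> r x = r u \<and> d x = d v \<and>
    u \<in> arrows G \<and> v \<in> arrows G \<and> x \<in> arrows G"
  using assms by (blast elim: setmultE)

text \<open>The arrow \<open>u\<close> of \<open>U\<close> with range \<open>r x\<close> is the only
  possible left factor of \<open>x\<close>, so the right factor must be
  \<open>iv u \<cdot> x\<close>. Membership in a product thus becomes a preimage condition, used for
  openness of products and for evaluating convolutions.\<close>

lemma setmult_iff:
  assumes "bisection G U" "u \<in> U" "V \<subseteq> arrows G" "x \<in> arrows G" "r u = r x"
  shows "x \<in> U \<odot> V \<longleftrightarrow> iv u \<cdot> x \<in> V"
proof
  have ua: "u \<in> arrows G" using assms bisection_arrows by auto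
  { assume "x \<in> U \<odot> V"
    then obtain u' v where *: "u' \<in> U" "v \<in> V" "d u' = r v" "x = u' \<cdot> v" "r x = r u'" "v \<in> arrows G"
      using setmultD[of x U V] assms unfolding bisection_def by blast
    then have "u' = u" using assms bisection_r_eq by metis
    then show "iv u \<cdot> x \<in> V" using * ua by (simp add: inv_cancel) }
  { assume v: "iv u \<cdot> x \<in> V"
    have "d u = r (iv u \<cdot> x)" using ua assms by (simp add: r_mult inv_closed d_inv r_inv)
    then have "u \<cdot> (iv u \<cdot> x) \<in> U \<odot> V" using v assms by (intro setmultI)
    then show "x \<in> U \<odot> V" using ua assms by (simp add: cancel_inv) }
qed

lemma bisection_setmult:
  assumes "bisection G U" "bisection G V"
  shows "bisection G (U \<odot> V)"
proof -
  have a: "U \<subseteq> arrows G" "V \<subseteq> arrows G" using assms by (auto simp: bisection_def)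
  have "x = y" if xy: "x \<in> U \<odot> V" "y \<in> U \<odot> V" "r x = r y \<or> d x = d y" for x y
  proof -
    obtain u v where x: "u \<in> U" "v \<in> V" "d u = r v" "x = u \<cdot> v" "r x = r u" "d x = d v"
      using setmultD[OF xy(1) a] by blast
    obtain u' v' where y: "u' \<in> U" "v' \<in> V" "d u' = r v'" "y = u' \<cdot> v'" "r y = r u'" "d y = d v'"
      using setmultD[OF xy(2) a] by blast
    \<comment> \<open>Equal ranges identify the left factors, equal domains the right ones; the
      matching conditions then carry the equality to the other factor.\<close>
    have "u = u' \<or> v = v'" using xy x y assms bisection_r_eq bisection_d_eq by metis
    then have "u = u' \<and> v = v'" using x y assms bisection_r_eq bisection_d_eq by metis
    then show ?thesis using x y by simp
  qed
  moreover have "U \<odot> V \<subseteq> arrows G" using a by (auto elim!: setmultE)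
  ultimately show ?thesis unfolding bisection_def inj_on_def by metis
qed

lemma setmult_assoc:
  assumes "U \<subseteq> arrows G" "V \<subseteq> arrows G" "W \<subseteq> arrows G"
  shows "(U \<odot> V) \<odot> W = U \<odot> (V \<odot> W)"
proof -
  have uv: "U \<odot> V \<subseteq> arrows G" and vw: "V \<odot> W \<subseteq> arrows G"
    using assms by (auto elim!: setmultE)
  show ?thesis
  proof (intro equalityI subsetI)
    fix x assume "x \<in> (U \<odot> V) \<odot> W"
    then obtain y w where y: "y \<in> U \<odot> V" "w \<in> W" "d y = r w" "x = y \<cdot> w" "w \<in> arrows G"
      using setmultD[OF _ uv assms(3)] by blast
    obtain u v where *: "u \<in> U" "v \<in> V" "d u = r v" "y = u \<cdot> v" "d y = d v" "u \<in> arrows G" "v \<in> arrows G"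
      using setmultD[OF y(1) assms(1,2)] by blast
    have "x = u \<cdot> (v \<cdot> w)" using * y by (simp add: mult_assoc')
    then show "x \<in> U \<odot> (V \<odot> W)" using * y by (auto intro!: setmultI simp: r_mult)
  next
    fix x assume "x \<in> U \<odot> (V \<odot> W)"
    then obtain u y where y: "u \<in> U" "y \<in> V \<odot> W" "d u = r y" "x = u \<cdot> y" "u \<in> arrows G"
      using setmultD[OF _ assms(1) vw] by blast
    obtain v w where *: "v \<in> V" "w \<in> W" "d v = r w" "y = v \<cdot> w" "r y = r v" "v \<in> arrows G" "w \<in> arrows G"
      using setmultD[OF y(2) assms(2,3)] by blast
    have "x = (u \<cdot> v) \<cdot> w" using * y by (simp add: mult_assoc')
    then show "x \<in> (U \<odot> V) \<odot> W" using * y by (auto intro!: setmultI simp: d_mult)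
  qed
qed

lemma bisection_inv:
  assumes "bisection G U"
  shows "bisection G (iv ` U)"
proof -
  have a: "U \<subseteq> arrows G" using assms by (auto simp: bisection_def)
  then show ?thesis using assms
    by (auto simp: bisection_def inj_on_def d_inv r_inv inv_closed subset_iff)
qed

lemma iv_iv_image: "U \<subseteq> arrows G \<Longrightarrow> iv ` iv ` U = U"
  by (force simp: inv_inv image_image subset_iff)

lemma mem_iv_image: "U \<subseteq> arrows G \<Longrightarrow> x \<in> iv ` U \<longleftrightarrow> x \<in> arrows G \<and> iv x \<in> U"
  by (force simp: inv_inv inv_closed subset_iff)

lemma r_iv_image: "U \<subseteq> arrows G \<Longrightarrow> r ` iv ` U = d ` U"
  by (force simp: r_inv image_image subset_iff)

lemma setmult_inv_self:
  assumes "bisection G U"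
  shows "U \<odot> (iv ` U) \<odot> U = U"
proof (intro equalityI subsetI)
  have a: "U \<subseteq> arrows G" "iv ` U \<subseteq> arrows G" using assms bisection_inv by (auto simp: bisection_def)
  have a': "U \<odot> (iv ` U) \<subseteq> arrows G" using a by (auto elim!: setmultE)
  { fix x assume "x \<in> U \<odot> (iv ` U) \<odot> U"
    then obtain y w where y: "y \<in> U \<odot> iv ` U" "w \<in> U" "d y = r w" "x = y \<cdot> w"
      using setmultD[of x "U \<odot> iv ` U" U] a a' by blast
    then obtain u v where *: "u \<in> U" "v \<in> U" "d u = r (iv v)" "y = u \<cdot> iv v" "d y = d (iv v)"
      "u \<in> arrows G" "v \<in> arrows G"
      using setmultD[of y U "iv ` U"] a by blast
    then have "u = v" using assms bisection_d_eq by (metis r_inv)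
    moreover have "w = v" using * y assms bisection_r_eq by (metis d_inv)
    ultimately have "u = v" "w = v" by auto
    then show "x \<in> U" using * y by (simp add: mult_inv_self ran_mult_self) }
  { fix x assume x: "x \<in> U"
    then have xa: "x \<in> arrows G" using a by auto
    have "x = (x \<cdot> iv x) \<cdot> x" using xa by (simp add: mult_inv_self ran_mult_self)
    moreover have "\<dots> \<in> U \<odot> (iv ` U) \<odot> U"
      using x xa by (auto intro!: setmultI simp: r_inv d_mult inv_closed d_inv)
    ultimately show "x \<in> U \<odot> (iv ` U) \<odot> U" by simp }
qed

text \<open>Write \<open>u\<close> in \<open>U\<close> as \<open>(u' \<cdot> v) \<cdot> w\<close>.
  The range forces \<open>u' = u\<close> and the domain forces \<open>w = u\<close>, so
  \<open>v\<close> is the inverse of \<open>u\<close>.\<close>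

lemma setmult_inv_subset:
  assumes "bisection G U" "bisection G V" "U \<odot> V \<odot> U = U"
  shows "iv ` U \<subseteq> V"
proof clarify
  fix u assume u: "u \<in> U"
  have a: "U \<subseteq> arrows G" "V \<subseteq> arrows G" using assms by (auto simp: bisection_def)
  have a': "U \<odot> V \<subseteq> arrows G" using a by (auto elim!: setmultE)
  have "u \<in> U \<odot> V \<odot> U" using assms u by simp
  then obtain y w where y: "y \<in> U \<odot> V" "w \<in> U" "d y = r w" "u = y \<cdot> w" "r u = r y" "d u = d w"
    using setmultD[of u "U \<odot> V" U] a a' by blast
  then obtain u' v where *: "u' \<in> U" "v \<in> V" "d u' = r v" "y = u' \<cdot> v" "r y = r u'" "d y = d v"
      "u' \<in> arrows G" "v \<in> arrows G"
    using setmultD[of y U V] a by blast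
  have "w = u" using u y bisection_d_eq[OF assms(1)] by metis
  moreover have "u' = u" using u y * bisection_r_eq[OF assms(1)] by metis
  ultimately have "d u = r v" "d v = r u" "(u \<cdot> v) \<cdot> u = u" "u \<in> arrows G" using y * by metis+
  then have "v = iv u" using * by (intro inv_unique)
  then show "iv u \<in> V" using * by simp
qed

lemma setmult_inverse_unique:
  assumes "bisection G U" "bisection G V"
  shows "U \<odot> V \<odot> U = U \<and> V \<odot> U \<odot> V = V \<longleftrightarrow> V = iv ` U"
proof
  have a: "U \<subseteq> arrows G" "V \<subseteq> arrows G" using assms by (auto simp: bisection_def)
  { assume *: "U \<odot> V \<odot> U = U \<and> V \<odot> U \<odot> V = V"
    then have "iv ` U \<subseteq> V" "iv ` V \<subseteq> U" using assms setmult_inv_subset by auto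
    then have "iv ` iv ` V \<subseteq> iv ` U" by blast
    then show "V = iv ` U" using \<open>iv ` U \<subseteq> V\<close> a by (simp add: iv_iv_image) }
  { assume V: "V = iv ` U"
    show "U \<odot> V \<odot> U = U \<and> V \<odot> U \<odot> V = V"
      using setmult_inv_self[OF assms(1)] setmult_inv_self[OF assms(2)] a
      unfolding V by (simp add: iv_iv_image) }
qed

text \<open>In a factorisation \<open>x = u \<cdot> v\<close> the range determines \<open>u\<close>
  and the domain determines \<open>v\<close>, so both equal \<open>x\<close>, which is then an
  idempotent arrow.\<close>

lemma setmult_idempotent_units:
  assumes "bisection G U" "U \<odot> U = U"
  shows "U \<subseteq> units G"
proof
  fix x assume x: "x \<in> U"
  have a: "U \<subseteq> arrows G" using assms by (auto simp: bisection_def)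
  have "x \<in> U \<odot> U" using assms x by simp
  then obtain u v where *: "u \<in> U" "v \<in> U" "d u = r v" "x = u \<cdot> v" "r x = r u" "d x = d v"
    using setmultD[of x U U] a by blast
  have "u = x" using * x bisection_r_eq[OF assms(1)] by metis
  moreover have "v = x" using * x bisection_d_eq[OF assms(1)] by metis
  ultimately have "d x = r x" "x \<cdot> x = x" "x \<in> arrows G" using * a by (metis, metis, blast)
  then show "x \<in> units G" by (intro idempotent_unit)
qed

text \<open>Multiplication by units is restriction of the domain; this is why the natural order of
  bisections is inclusion.\<close>

lemma setmult_units:
  assumes "U \<subseteq> arrows G" "E \<subseteq> units G"
  shows "U \<odot> E = {u \<in> U. d u \<in> E}"
proof (intro equalityI subsetI)
  fix x assume "x \<in> U \<odot> E"
  then show "x \<in> {u \<in> U. d u \<in> E}" using assms mult_dom unfolding setmult_def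
    by (force simp: units_r subset_iff)
next
  fix x assume x: "x \<in> {u \<in> U. d u \<in> E}"
  then have "x \<cdot> d x \<in> U \<odot> E" using assms by (intro setmultI) (auto simp: r_d subset_iff)
  then show "x \<in> U \<odot> E" using x assms mult_dom by auto
qed

lemma d_image_setmult:
  assumes "U \<subseteq> arrows G" "V \<subseteq> arrows G"
  shows "d ` (U \<odot> V) = {d v | v. v \<in> V \<and> r v \<in> d ` U}"
proof (intro equalityI subsetI)
  fix x assume "x \<in> d ` (U \<odot> V)"
  then show "x \<in> {d v | v. v \<in> V \<and> r v \<in> d ` U}" using setmultD[OF _ assms] by force
next
  fix x assume "x \<in> {d v | v. v \<in> V \<and> r v \<in> d ` U}"
  then obtain u v where "u \<in> U" "v \<in> V" "d u = r v" "x = d v" by auto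
  then have "x = d (u \<cdot> v)" "u \<cdot> v \<in> U \<odot> V" using assms by (auto simp: d_mult subset_iff intro: setmultI)
  then show "x \<in> d ` (U \<odot> V)" by auto
qed

end

section \<open>Compact open bisections\<close>

locale hausdorff_ample_groupoid = ample_groupoid +
  assumes hausdorff: "Hausdorff_space (gtop G)"
begin

abbreviation X where "X \<equiv> gtop G"
abbreviation cob where "cob \<equiv> compact_open_bisections G"
abbreviation sec where "sec U \<equiv> inv_into U r"

lemma topspace_X [simp]: "topspace X = arrows G"
  by (simp add: arrows_def)

lemma topspace_unit_top [simp]: "topspace (unit_top G) = units G"
  using units_arrows by (auto simp: unit_top_def)

section \<open>Continuity and openness of the structure maps\<close>

lemma continuous_map_gmult:
  assumes "continuous_map Z X f" "continuous_map Z X g"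
    and "\<And>z. z \<in> topspace Z \<Longrightarrow> d (f z) = r (g z)"
  shows "continuous_map Z X (\<lambda>z. f z \<cdot> g z)"
proof -
  have "f z \<in> arrows G" "g z \<in> arrows G" if "z \<in> topspace Z" for z
    using assms that by (auto simp: continuous_map_def)
  then have "continuous_map Z (subtopology (prod_topology X X) (composable G)) (\<lambda>z. (f z, g z))"
    using assms by (auto intro!: continuous_map_into_subtopology continuous_map_pairedI composableI)
  from continuous_map_compose[OF this continuous_mult] show ?thesis by (simp add: o_def)
qed

lemma continuous_map_ginv:
  assumes "continuous_map Z X f"
  shows "continuous_map Z X (\<lambda>z. iv (f z))"
  using continuous_map_compose[OF assms continuous_inv] by (simp add: o_def)

lemma continuous_map_r: "continuous_map X X r"
  unfolding ran_map_def
  by (intro continuous_map_gmult continuous_map_ginv continuous_map_id[unfolded id_def]) (simp add: r_inv)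

lemma continuous_map_d: "continuous_map X X d"
  unfolding dom_map_def
  by (intro continuous_map_gmult continuous_map_ginv continuous_map_id[unfolded id_def]) (simp add: d_inv)

lemma local_section:
  assumes "x \<in> arrows G"
  obtains U where "openin X U" "x \<in> U" "openin (unit_top G) (r ` U)" "inj_on r U"
    "homeomorphic_map (subtopology X U) (subtopology (unit_top G) (r ` U)) r"
proof -
  obtain U where U: "openin X U" "x \<in> U" "openin (unit_top G) (r ` U)"
    "homeomorphic_map (subtopology X U) (subtopology (unit_top G) (r ` U)) r"
    using ran_local_homeomorphism assms unfolding local_homeomorphism_def by auto
  moreover have "U \<subseteq> topspace X" using U(1) by (rule openin_subset)
  then have "inj_on r U" using homeomorphic_imp_injective_map[OF U(4)] by (simp add: inf.absorb2)
  ultimately show thesis using that by blast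
qed

lemma openin_units: "openin X (units G)"
proof (subst openin_subopen, intro ballI)
  fix x assume x: "x \<in> units G"
  then obtain U where U: "openin X U" "x \<in> U" "inj_on r U" using local_section units_arrows by metis
  have sub: "U \<subseteq> arrows G" using openin_subset[OF U(1)] by simp
  \<comment> \<open>For \<open>y\<close> in \<open>?T\<close> both \<open>y\<close> and
    \<open>r y\<close> lie in \<open>U\<close> and have the same range; injectivity of
    \<open>r\<close> on \<open>U\<close> gives \<open>r y = y\<close>, so \<open>y\<close> is a
    unit.\<close>
  let ?T = "{y \<in> U. r y \<in> U}"
  have "openin X ?T" using continuous_map_r U by (intro openin_continuous_map_preimage_gen)
  moreover have "x \<in> ?T" using x U by (simp add: units_r)
  moreover have "r y = y" if "y \<in> ?T" for y using that sub inj_onD[OF U(3), of "r y" y] r_r by auto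
  then have "?T \<subseteq> units G" using sub units_iff by blast
  ultimately show "\<exists>T. openin X T \<and> x \<in> T \<and> T \<subseteq> units G" by blast
qed

lemma openin_unit_top: "openin (unit_top G) U \<longleftrightarrow> openin X U \<and> U \<subseteq> units G"
  unfolding unit_top_def using openin_units by (rule openin_open_subtopology)

lemma compactin_unit_top: "compactin (unit_top G) U \<longleftrightarrow> compactin X U \<and> U \<subseteq> units G"
  unfolding unit_top_def by (rule compactin_subtopology)

text \<open>Local homeomorphisms are open: near each point \<open>r\<close> sends open sets to open
  subsets of the range of \<open>W\<close>, which is itself open.\<close>

lemma openin_r_image:
  assumes U: "openin X U"
  shows "openin X (r ` U)"
proof (subst openin_subopen, intro ballI)
  fix y assume "y \<in> r ` U"
  then obtain x where x: "x \<in> U" "y = r x" by auto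
  then have "x \<in> arrows G" using openin_subset[OF U] by auto
  then obtain W where W: "openin X W" "x \<in> W" "openin (unit_top G) (r ` W)"
    "homeomorphic_map (subtopology X W) (subtopology (unit_top G) (r ` W)) r"
    using local_section by metis
  have "openin (subtopology X W) (W \<inter> U)" using U by (simp add: openin_subtopology_Int2)
  then have "openin (subtopology (unit_top G) (r ` W)) (r ` (W \<inter> U))"
    using homeomorphic_imp_open_map[OF W(4)] by (auto simp: open_map_def)
  then have "openin X (r ` (W \<inter> U))" using W(3) openin_trans_full openin_unit_top by blast
  then show "\<exists>T. openin X T \<and> y \<in> T \<and> T \<subseteq> r ` U" using x W by blast
qed

section \<open>Closure properties of compact open bisections\<close>

lemma cob_iff: "U \<in> cob \<longleftrightarrow> bisection G U \<and> openin X U \<and> compactin X U"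
  \<comment> \<open>The Hausdorff clause of compactness is inherited from the arrow space.\<close>
  unfolding compact_open_bisections_def using hausdorff Hausdorff_space_subtopology by auto

lemma cob_bisection: "U \<in> cob \<Longrightarrow> bisection G U"
  by (simp add: cob_iff)

lemma cob_arrows: "U \<in> cob \<Longrightarrow> U \<subseteq> arrows G"
  by (auto simp: cob_iff bisection_def)

text \<open>Compact subsets of the Hausdorff unit space are closed, so the range is clopen there;
  this later makes extension by zero continuous.\<close>

lemma cob_r_image:
  assumes "U \<in> cob"
  shows "openin X (r ` U)" "compactin X (r ` U)" "r ` U \<subseteq> units G"
    "openin (unit_top G) (r ` U)" "closedin (unit_top G) (r ` U)"
proof -
  show o: "openin X (r ` U)" using assms openin_r_image by (simp add: cob_iff)
  show c: "compactin X (r ` U)" using assms continuous_map_r image_compactin by (auto simp: cob_iff)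
  show u: "r ` U \<subseteq> units G" using cob_arrows[OF assms] r_units by auto
  show "openin (unit_top G) (r ` U)" using o u openin_unit_top by simp
  show "closedin (unit_top G) (r ` U)"
    using c u compactin_unit_top units_Hausdorff by (auto intro: compactin_imp_closedin)
qed

lemma cob_inv: "U \<in> cob \<Longrightarrow> iv ` U \<in> cob"
proof -
  assume U: "U \<in> cob"
  have "iv ` U = {x \<in> topspace X. iv x \<in> U}" using mem_iv_image cob_arrows[OF U] by auto
  then have "openin X (iv ` U)"
    using U openin_continuous_map_preimage[OF continuous_inv, of U] by (simp add: cob_iff)
  moreover have "compactin X (iv ` U)" using U image_compactin[OF _ continuous_inv] by (simp add: cob_iff)
  ultimately show ?thesis using U bisection_inv by (simp add: cob_iff)
qed

text \<open>In a Hausdorff space intersections of compact sets are compact. The comparison of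
  overlapping bisections in \<open>redistribute\<close> depends on this.\<close>

lemma cob_Int: "U \<in> cob \<Longrightarrow> V \<in> cob \<Longrightarrow> U \<inter> V \<in> cob"
  using hausdorff by (auto simp: cob_iff compactin_Int openin_Int bisection_def intro: inj_on_subset)

lemma cob_units: "openin X E \<Longrightarrow> compactin X E \<Longrightarrow> E \<subseteq> units G \<Longrightarrow> E \<in> cob"
  unfolding cob_iff bisection_def inj_on_def using units_arrows units_d units_r by (simp add: subset_iff)

lemma cob_d_image: "U \<in> cob \<Longrightarrow> d ` U \<in> cob"
  using cob_r_image[OF cob_inv] cob_units by (simp add: cob_arrows r_iv_image)

lemma sec_r: "U \<in> cob \<Longrightarrow> u \<in> U \<Longrightarrow> sec U (r u) = u"
  by (simp add: cob_iff bisection_def)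

lemma sec_in: "x \<in> r ` U \<Longrightarrow> sec U x \<in> U"
  by (rule inv_into_into)

lemma r_sec: "x \<in> r ` U \<Longrightarrow> r (sec U x) = x"
  by (rule f_inv_into_f)

text \<open>On \<open>U\<close>, \<open>r\<close> is a continuous injection from a compact space to
  a Hausdorff space, hence a homeomorphism onto its image, with inverse
  \<open>sec U\<close>.\<close>

lemma continuous_map_sec:
  assumes "U \<in> cob"
  shows "continuous_map (subtopology X (r ` U)) X (sec U)"
proof -
  have top: "topspace (subtopology X U) = U" "topspace (subtopology X (r ` U)) = r ` U"
    using cob_arrows[OF assms] r_closed by auto
  have "homeomorphic_map (subtopology X U) (subtopology X (r ` U)) r"
  proof (rule continuous_imp_homeomorphic_map)
    show "continuous_map (subtopology X U) (subtopology X (r ` U)) r"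
      by (rule continuous_map_into_subtopology[OF continuous_map_from_subtopology[OF continuous_map_r]]) auto
    show "compact_space (subtopology X U)" using assms by (simp add: cob_iff compact_space_subtopology)
    show "Hausdorff_space (subtopology X (r ` U))" using hausdorff Hausdorff_space_subtopology by auto
    show "r ` topspace (subtopology X U) = topspace (subtopology X (r ` U))" by (simp only: top)
    show "inj_on r (topspace (subtopology X U))" using assms unfolding top by (simp add: cob_iff bisection_def)
  qed
  then obtain g where g: "continuous_map (subtopology X (r ` U)) (subtopology X U) g" "\<forall>x\<in>U. g (r x) = x"
    unfolding homeomorphic_map_maps homeomorphic_maps_def top by blast
  have "g y = sec U y" if "y \<in> topspace (subtopology X (r ` U))" for y
    using that g(2) sec_r[OF assms] unfolding top by auto
  then show ?thesis
    using continuous_map_eq[OF continuous_map_into_fulltopology[OF g(1)]] by blast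
qed

text \<open>Openness and compactness use two descriptions of the product: as a preimage of
  \<open>V\<close>, and as a continuous image of a compact part of \<open>U\<close>.\<close>

lemma cob_setmult:
  assumes U: "U \<in> cob" and V: "V \<in> cob"
  shows "U \<odot> V \<in> cob"
proof -
  have a: "U \<subseteq> arrows G" "V \<subseteq> arrows G" using U V cob_arrows by auto
  have "openin X (U \<odot> V)"
  proof -
    let ?R = "{x \<in> arrows G. r x \<in> r ` U}"
    \<comment> \<open>\<open>?g x\<close> is the only possible right factor of \<open>x\<close>; by
      \<open>setmult_iff\<close> the product consists of the \<open>x\<close> in the open set
      \<open>?R\<close> with \<open>?g x \<in> V\<close>.\<close>
    let ?g = "\<lambda>x. iv (sec U (r x)) \<cdot> x"
    have R: "openin X ?R"
      using openin_continuous_map_preimage[OF continuous_map_r cob_r_image(1)[OF U]] by simp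
    have topR: "topspace (subtopology X ?R) = ?R" by auto
    have secR: "sec U (r x) \<in> U" "sec U (r x) \<in> arrows G" "r (sec U (r x)) = r x" if "x \<in> ?R" for x
      using that sec_in[of "r x" U] r_sec[of "r x" U] a by auto
    have "continuous_map (subtopology X ?R) (subtopology X (r ` U)) r"
      by (rule continuous_map_into_subtopology[OF continuous_map_from_subtopology[OF continuous_map_r]]) auto
    from continuous_map_compose[OF this continuous_map_sec[OF U]]
    have "continuous_map (subtopology X ?R) X (\<lambda>x. sec U (r x))" by (simp add: o_def)
    then have "continuous_map (subtopology X ?R) X ?g"
      using secR
      by (intro continuous_map_gmult continuous_map_ginv continuous_map_from_subtopology[OF continuous_map_id[unfolded id_def]])
        (auto simp: d_inv)
    then have "openin (subtopology X ?R) {x \<in> ?R. ?g x \<in> V}"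
      using openin_continuous_map_preimage[of "subtopology X ?R" X ?g V] V unfolding topR by (simp add: cob_iff)
    then have "openin X {x \<in> ?R. ?g x \<in> V}" using R openin_trans_full by blast
    moreover have "{x \<in> ?R. ?g x \<in> V} = U \<odot> V"
    proof (intro equalityI subsetI)
      fix x assume "x \<in> {x \<in> ?R. ?g x \<in> V}"
      then show "x \<in> U \<odot> V"
        using setmult_iff[OF cob_bisection[OF U], of "sec U (r x)" V x] secR[of x] a by auto
    next
      fix x assume x: "x \<in> U \<odot> V"
      then have "x \<in> ?R" using setmultD[OF x a] by auto
      then show "x \<in> {x \<in> ?R. ?g x \<in> V}"
        using x setmult_iff[OF cob_bisection[OF U], of "sec U (r x)" V x] secR[of x] a by auto
    qed
    ultimately show ?thesis by simp
  qed
  moreover have "compactin X (U \<odot> V)"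
  proof -
    \<comment> \<open>These are the left factors that have a partner, namely
      \<open>sec V (d u)\<close>. The set is compact because the range of \<open>V\<close> is
      compact, hence closed in the arrow space.\<close>
    let ?W = "{u \<in> U. d u \<in> r ` V}"
    have W: "compactin X ?W"
    proof -
      have "closedin X (r ` V)" using cob_r_image(2)[OF V] hausdorff compactin_imp_closedin by blast
      then have "closedin X {u \<in> topspace X. d u \<in> r ` V}"
        using closedin_continuous_map_preimage[OF continuous_map_d] by blast
      then have "compactin X (U \<inter> {u \<in> topspace X. d u \<in> r ` V})"
        using U compact_Int_closedin by (auto simp: cob_iff)
      moreover have "U \<inter> {u \<in> topspace X. d u \<in> r ` V} = ?W" using a by auto
      ultimately show ?thesis by simp
    qed
    have topW: "topspace (subtopology X ?W) = ?W" using a by auto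
    have "continuous_map (subtopology X ?W) (subtopology X (r ` V)) d"
      by (rule continuous_map_into_subtopology[OF continuous_map_from_subtopology[OF continuous_map_d]]) auto
    from continuous_map_compose[OF this continuous_map_sec[OF V]]
    have "continuous_map (subtopology X ?W) X (\<lambda>u. sec V (d u))" by (simp add: o_def)
    then have "continuous_map (subtopology X ?W) X (\<lambda>u. u \<cdot> sec V (d u))"
      by (intro continuous_map_gmult continuous_map_from_subtopology[OF continuous_map_id[unfolded id_def]])
        (auto simp: r_sec)
    moreover have "compactin (subtopology X ?W) ?W" using W by (simp add: compactin_subtopology)
    ultimately have "compactin X ((\<lambda>u. u \<cdot> sec V (d u)) ` ?W)" using image_compactin by blast
    moreover have "(\<lambda>u. u \<cdot> sec V (d u)) ` ?W = U \<odot> V"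
    proof (intro equalityI subsetI)
      fix x assume "x \<in> (\<lambda>u. u \<cdot> sec V (d u)) ` ?W"
      then show "x \<in> U \<odot> V" using sec_in r_sec by (auto intro!: setmultI simp: sec_r[OF V])
    next
      fix x assume "x \<in> U \<odot> V"
      then obtain u v where "u \<in> U" "v \<in> V" "d u = r v" "x = u \<cdot> v" using setmultD[OF _ a] by blast
      then have "u \<in> ?W" "x = u \<cdot> sec V (d u)" using sec_r[OF V] by auto
      then show "x \<in> (\<lambda>u. u \<cdot> sec V (d u)) ` ?W" by blast
    qed
    ultimately show ?thesis by simp
  qed
  ultimately show ?thesis using U V bisection_setmult by (simp add: cob_iff)
qed

section \<open>The inverse semigroup, its idempotents and its order\<close>

abbreviation B where "B \<equiv> bisection_semigroup G"

lemma B_simps [simp]: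
  "carrier B = cob" "mult B U V = U \<odot> V" "star B U = iv ` U"
  by (simp_all add: bisection_semigroup_def setmult_def)

lemma inverse_semigroup_B: "inverse_semigroup B"
proof
  show "mult B (mult B U V) W = mult B U (mult B V W)"
    if "U \<in> carrier B" "V \<in> carrier B" "W \<in> carrier B" for U V W
    using that by (simp add: cob_arrows setmult_assoc)
  show "mult B (mult B U V) U = U \<and> mult B (mult B V U) V = V \<longleftrightarrow> V = star B U"
    if "U \<in> carrier B" "V \<in> carrier B" for U V
    using that setmult_inverse_unique[of U V] by (simp add: cob_bisection)
qed (simp_all add: cob_setmult cob_inv)

lemma idempotents_B: "E \<in> idempotents B \<longleftrightarrow> E \<in> cob \<and> E \<subseteq> units G"
proof
  show "E \<in> idempotents B \<Longrightarrow> E \<in> cob \<and> E \<subseteq> units G"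
    using setmult_idempotent_units cob_bisection by (auto simp: idempotents_def)
  assume "E \<in> cob \<and> E \<subseteq> units G"
  moreover from this have "{u \<in> E. d u \<in> E} = E" using units_d by force
  ultimately show "E \<in> idempotents B"
    using setmult_units[of E E] by (simp add: idempotents_def cob_arrows)
qed

lemma natural_le_B: "natural_le B U V \<longleftrightarrow> U \<in> cob \<and> V \<in> cob \<and> U \<subseteq> V"
proof
  assume "natural_le B U V"
  then show "U \<in> cob \<and> V \<in> cob \<and> U \<subseteq> V"
    by (auto simp: natural_le_def idempotents_B setmult_units cob_arrows)
next
  assume *: "U \<in> cob \<and> V \<in> cob \<and> U \<subseteq> V"
  \<comment> \<open>The witness is the domain of \<open>U\<close>: as \<open>d\<close> is injective
    on \<open>V\<close>, restricting \<open>V\<close> to it leaves exactly \<open>U\<close>.\<close>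
  then have "d ` U \<in> idempotents B" using cob_d_image cob_arrows d_units by (auto simp: idempotents_B)
  moreover have "d ` U \<subseteq> units G" using * cob_arrows d_units by auto
  then have "V \<odot> d ` U = {v \<in> V. d v \<in> d ` U}" using * by (simp add: setmult_units cob_arrows)
  then have "U = V \<odot> d ` U" using * bisection_d_eq[OF cob_bisection] by blast
  ultimately show "natural_le B U V" using * by (auto simp: natural_le_def)
qed

end

section \<open>The spectral action\<close>

lemma additive_subgroup_closedI:
  fixes R (structure)
  assumes "H \<subseteq> carrier R" "\<zero> \<in> H" "\<And>x y. x \<in> H \<Longrightarrow> y \<in> H \<Longrightarrow> x \<oplus> y \<in> H"
    "\<And>x. x \<in> H \<Longrightarrow> \<ominus> x \<in> H"
  shows "additive_subgroup H R"
  using assms by (intro additive_subgroupI subgroup.intro) (simp_all add: a_inv_def)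

lemma continuous_map_mult_algebra:
  fixes f g :: "'a \<Rightarrow> 'b :: real_normed_algebra"
  shows "continuous_map X euclidean f \<Longrightarrow> continuous_map X euclidean g
    \<Longrightarrow> continuous_map X euclidean (\<lambda>x. f x * g x)"
  by (simp add: continuous_map_atin tendsto_mult)

lemma continuous_map_extend_zero:
  fixes f :: "'a \<Rightarrow> 'b :: {topological_space, zero}"
  assumes "openin Y K" "closedin Y K" "continuous_map (subtopology Y K) euclidean f"
    and "\<And>x. x \<in> topspace Y \<Longrightarrow> x \<notin> K \<Longrightarrow> f x = 0"
  shows "continuous_map Y euclidean f"
  unfolding continuous_map_def
proof (intro conjI allI impI)
  fix S :: "'b set" assume "openin euclidean S"
  have K: "K \<subseteq> topspace Y" using assms(1) openin_subset by blast
  have "openin (subtopology Y K) {x \<in> topspace (subtopology Y K). f x \<in> S}"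
    using assms(3) \<open>openin euclidean S\<close> by (rule openin_continuous_map_preimage)
  moreover have "{x \<in> topspace (subtopology Y K). f x \<in> S} = {x \<in> K. f x \<in> S}" using K by auto
  ultimately have 1: "openin Y {x \<in> K. f x \<in> S}" using assms(1) openin_trans_full by metis
  \<comment> \<open>The function is zero off \<open>K\<close>, so the complement of \<open>K\<close>
    belongs to the preimage of \<open>S\<close> exactly when \<open>0 \<in> S\<close>.\<close>
  have 2: "openin Y (if 0 \<in> S then topspace Y - K else {})" using assms(2) by (simp add: closedin_def)
  have "x \<in> K" if "x \<in> topspace Y" "f x \<in> S" "0 \<notin> S" for x using assms(4) that by metis
  moreover have "f x \<in> S" if "x \<in> topspace Y" "x \<notin> K" "0 \<in> S" for x using assms(4) that by metis
  ultimately have "{x \<in> topspace Y. f x \<in> S} = {x \<in> K. f x \<in> S} \<union> (if 0 \<in> S then topspace Y - K else {})"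
    using K by auto
  then show "openin Y {x \<in> topspace Y. f x \<in> S}" using openin_Un[OF 1 2] by simp
qed auto

context hausdorff_ample_groupoid
begin

section \<open>The ring of functions on the units and its ideals\<close>

abbreviation A where "A \<equiv> Cc_units G"
abbreviation D where "D \<equiv> bisection_ideal G"
abbreviation act where "act \<equiv> bisection_action G"

lemma A_simps [simp]:
  "zero A = (\<lambda>x. 0)" "add A f g = (\<lambda>x. f x + g x)" "mult A f g = (\<lambda>x. f x * g x)"
  by (simp_all add: Cc_units_def)

text \<open>The range of \<open>U\<close> is closed and compact. Hence it contains the closed
  support as soon as it contains the points of nonvanishing, and the support is then compact. From
  here on supports are handled pointwise.\<close>

lemma D_iff:
  assumes "U \<in> cob"
  shows "f \<in> D U \<longleftrightarrow> continuous_map (unit_top G) euclidean f \<and> (\<forall>x. x \<notin> r ` U \<longrightarrow> f x = 0)"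
    (is "_ \<longleftrightarrow> ?R")
proof
  note rU = cob_r_image[OF assms]
  { assume "f \<in> D U"
    then have f: "\<forall>x. x \<notin> units G \<longrightarrow> f x = 0" "continuous_map (unit_top G) euclidean f"
      "unit_support G f \<subseteq> r ` U" by (auto simp: bisection_ideal_def Cc_units_def)
    have "{x \<in> units G. f x \<noteq> 0} \<subseteq> r ` U"
      using f(3) closure_of_subset[of "{x \<in> units G. f x \<noteq> 0}" "unit_top G"]
      by (auto simp: unit_support_def)
    then show ?R using f by blast }
  { assume f: ?R
    then have sub: "unit_support G f \<subseteq> r ` U"
      unfolding unit_support_def using rU by (intro closure_of_minimal) auto
    moreover have "compactin (unit_top G) (unit_support G f)"
      using rU sub closed_compactin[of "unit_top G" "r ` U"] by (simp add: compactin_unit_top unit_support_def)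
    moreover have "\<forall>x. x \<notin> units G \<longrightarrow> f x = 0" using f rU(3) by (metis subsetD)
    ultimately show "f \<in> D U" using f by (simp add: bisection_ideal_def Cc_units_def) }
qed

lemma D_outside: "U \<in> cob \<Longrightarrow> f \<in> D U \<Longrightarrow> x \<notin> r ` U \<Longrightarrow> f x = 0"
  by (simp add: D_iff)

lemma r_image_idempotent: "K \<subseteq> units G \<Longrightarrow> r ` K = K"
  using units_r by (force simp: subset_iff)

lemma D_carrier: "f \<in> D U \<Longrightarrow> f \<in> carrier A"
  by (simp add: bisection_ideal_def)

text \<open>Compact open sets of units cover the compact support; the union of a finite subcover is
  compact open and, consisting of units, a bisection.\<close>

lemma carrier_A:
  assumes "f \<in> carrier A"
  obtains K where "K \<in> idempotents B" "f \<in> D K"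
proof -
  let ?\<U> = "{V. compactin (unit_top G) V \<and> openin (unit_top G) V}"
  have f: "\<forall>x. x \<notin> units G \<longrightarrow> f x = 0" "continuous_map (unit_top G) euclidean f"
    "compactin (unit_top G) (unit_support G f)" using assms by (auto simp: Cc_units_def)
  have "\<exists>V\<in>?\<U>. x \<in> V" if "x \<in> units G" for x
    using units_compact_open_basis openin_topspace[of "unit_top G"] that
    unfolding neighbourhood_base_of by fastforce
  then have "unit_support G f \<subseteq> \<Union>?\<U>"
    using compactin_subset_topspace[OF f(3)] by fastforce
  then obtain F where F: "finite F" "F \<subseteq> ?\<U>" "unit_support G f \<subseteq> \<Union>F"
    using compactinD[OF f(3), of ?\<U>] by auto
  have "compactin (unit_top G) (\<Union>F)" using F by (intro compactin_Union) auto
  moreover have "openin (unit_top G) (\<Union>F)" using F by (intro openin_Union) auto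
  ultimately have K: "\<Union>F \<in> idempotents B"
    using cob_units by (auto simp: idempotents_B openin_unit_top compactin_unit_top)
  then have "r ` (\<Union>F) = \<Union>F" by (intro r_image_idempotent) (simp add: idempotents_B)
  then have "f \<in> D (\<Union>F)" using F f assms by (simp add: bisection_ideal_def)
  then show thesis using that K by blast
qed

text \<open>Unions of bisections need not be bisections, but unions of sets of units are. Two
  functions thus share one \<open>D K\<close>, which reduces closure of \<open>A\<close> to closure
  of \<open>D K\<close>.\<close>

lemma carrier_A2:
  assumes "f \<in> carrier A" "g \<in> carrier A"
  obtains K where "K \<in> cob" "f \<in> D K" "g \<in> D K"
proof -
  obtain K where K: "K \<in> idempotents B" "f \<in> D K" using carrier_A assms by blast
  obtain L where L: "L \<in> idempotents B" "g \<in> D L" using carrier_A assms by blast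
  have "K \<union> L \<in> cob"
    using K L by (intro cob_units) (auto simp: idempotents_B cob_iff compactin_Un)
  moreover from this have "f \<in> D (K \<union> L)" "g \<in> D (K \<union> L)"
    using K L by (auto simp: idempotents_B D_iff)
  ultimately show thesis using that by blast
qed

lemma D_zero: "U \<in> cob \<Longrightarrow> (\<lambda>x. 0) \<in> D U"
  by (simp add: D_iff)

lemma D_add: "U \<in> cob \<Longrightarrow> f \<in> D U \<Longrightarrow> g \<in> D U \<Longrightarrow> (\<lambda>x. f x + g x) \<in> D U"
  by (simp add: D_iff continuous_map_add)

lemma D_minus: "U \<in> cob \<Longrightarrow> f \<in> D U \<Longrightarrow> (\<lambda>x. - f x) \<in> D U"
  by (simp add: D_iff)

lemma carrier_A_continuous: "f \<in> carrier A \<Longrightarrow> continuous_map (unit_top G) euclidean f"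
  by (simp add: Cc_units_def)

lemma D_mult: "U \<in> cob \<Longrightarrow> f \<in> D U \<Longrightarrow> g \<in> carrier A \<Longrightarrow> (\<lambda>x. f x * g x) \<in> D U"
  using carrier_A_continuous[of g] by (simp add: D_iff continuous_map_mult_algebra)

lemma D_mult_right: "U \<in> cob \<Longrightarrow> f \<in> carrier A \<Longrightarrow> g \<in> D U \<Longrightarrow> (\<lambda>x. f x * g x) \<in> D U"
  using D_mult[of U g f] by (simp add: mult.commute)

lemma empty_cob: "{} \<in> cob"
  by (simp add: cob_iff bisection_def)

lemma A_minus_closed: "f \<in> carrier A \<Longrightarrow> (\<lambda>x. - f x) \<in> carrier A"
  using carrier_A2[of f f] D_minus D_carrier by metis

lemma nonunital_ring_A: "nonunital_ring A"
proof -
  have add: "(\<lambda>x. f x + g x) \<in> carrier A" if "f \<in> carrier A" "g \<in> carrier A" for f g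
    using that carrier_A2[of f g] D_add D_carrier by metis
  have "abelian_group A"
  proof (rule abelian_groupI)
    show "\<zero>\<^bsub>A\<^esub> \<in> carrier A" using D_carrier[OF D_zero[OF empty_cob]] by simp
    show "\<exists>g\<in>carrier A. g \<oplus>\<^bsub>A\<^esub> f = \<zero>\<^bsub>A\<^esub>" if "f \<in> carrier A" for f
      using A_minus_closed[OF that] by (intro bexI[of _ "\<lambda>x. - f x"]) auto
  qed (auto simp: add add.assoc add.commute)
  moreover have "(\<lambda>x. f x * g x) \<in> carrier A" if "f \<in> carrier A" "g \<in> carrier A" for f g
    using that carrier_A2[of f g] D_mult D_carrier by metis
  ultimately show ?thesis
    by (intro nonunital_ring.intro nonunital_ring_axioms.intro) (auto simp: algebra_simps)
qed

lemma a_inv_A: "f \<in> carrier A \<Longrightarrow> a_inv A f = (\<lambda>x. - f x)"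
proof -
  assume f: "f \<in> carrier A"
  interpret A: nonunital_ring A by (rule nonunital_ring_A)
  show ?thesis using f A_minus_closed by (intro A.minus_equality) auto
qed

lemma finsum_A:
  assumes "finite I" "\<And>i. i \<in> I \<Longrightarrow> f i \<in> carrier A"
  shows "finsum A f I = (\<lambda>x. \<Sum>i\<in>I. f i x)"
proof -
  interpret A: nonunital_ring A by (rule nonunital_ring_A)
  show ?thesis using assms
  proof (induction I rule: finite_induct)
    case (insert i I)
    then show ?case by (subst A.finsum_insert) auto
  qed simp
qed

lemma two_sided_ideal_D:
  assumes "U \<in> cob"
  shows "two_sided_ideal (D U) A"
  unfolding two_sided_ideal_def
proof
  show "additive_subgroup (D U) A"
    using assms by (intro additive_subgroup_closedI) (auto simp: D_zero D_add D_carrier a_inv_A D_minus)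
qed (use assms in \<open>auto simp: D_mult D_mult_right\<close>)

text \<open>The unit element of \<open>D U\<close>, and the cut-off function of
  \<open>redistribute\<close>.\<close>

definition chi :: "_ \<Rightarrow> _ \<Rightarrow> complex" where
  "chi U x = (if x \<in> r ` U then 1 else 0)"

lemma chi_D:
  assumes "U \<in> cob"
  shows "chi U \<in> D U"
proof -
  have "continuous_map (subtopology (unit_top G) (r ` U)) euclidean (chi U)"
    by (rule continuous_map_eq[of _ _ "\<lambda>x. 1"]) (auto simp: chi_def)
  then have "continuous_map (unit_top G) euclidean (chi U)"
    using cob_r_image[OF assms] by (rule_tac continuous_map_extend_zero[of _ "r ` U"]) (auto simp: chi_def)
  then show ?thesis using assms by (simp add: D_iff chi_def)
qed

lemma chi_mult: "U \<in> cob \<Longrightarrow> f \<in> D U \<Longrightarrow> (\<lambda>x. chi U x * f x) = f"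
  by (auto simp: D_iff chi_def fun_eq_iff)

lemma chi_mult_right: "U \<in> cob \<Longrightarrow> f \<in> D U \<Longrightarrow> (\<lambda>x. f x * chi U x) = f"
  using chi_mult[of U f] by (simp add: mult.commute)

section \<open>The action on functions\<close>

lemma act_r: "U \<in> cob \<Longrightarrow> u \<in> U \<Longrightarrow> act U f (r u) = f (d u)"
  by (simp add: bisection_action_def sec_r)

lemma act_outside: "x \<notin> r ` U \<Longrightarrow> act U f x = 0"
  by (simp add: bisection_action_def)

text \<open>Parametrising the range by the arrows of \<open>U\<close> removes
  \<open>inv_into\<close> from all later computations with the action.\<close>

lemma act_eqI:
  assumes "U \<in> cob" "\<And>u. u \<in> U \<Longrightarrow> f (d u) = g (r u)" "\<And>x. x \<notin> r ` U \<Longrightarrow> g x = 0"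
  shows "act U f = g"
proof
  fix x show "act U f x = g x"
    using assms by (cases "x \<in> r ` U") (auto simp: act_r act_outside)
qed

text \<open>On the clopen range of \<open>U\<close> the function is the continuous composite of
  \<open>sec U\<close>, \<open>d\<close> and \<open>f\<close>; elsewhere it is zero.\<close>

lemma act_closed:
  assumes U: "U \<in> cob" and f: "f \<in> carrier A"
  shows "act U f \<in> D U"
proof -
  note rU = cob_r_image[OF U]
  have eq: "subtopology (unit_top G) (r ` U) = subtopology X (r ` U)"
    using rU by (simp add: unit_top_def subtopology_subtopology inf.absorb2)
  have "continuous_map X (unit_top G) d"
    unfolding unit_top_def using continuous_map_d d_units by (auto intro!: continuous_map_into_subtopology)
  from continuous_map_compose[OF continuous_map_sec[OF U] this]
  have "continuous_map (subtopology X (r ` U)) (unit_top G) (d \<circ> sec U)" .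
  from continuous_map_compose[OF this carrier_A_continuous[OF f]]
  have "continuous_map (subtopology X (r ` U)) euclidean (f \<circ> (d \<circ> sec U))" .
  then have "continuous_map (subtopology X (r ` U)) euclidean (act U f)"
    by (rule continuous_map_eq) (auto simp: bisection_action_def)
  then have "continuous_map (unit_top G) euclidean (act U f)"
    using rU by (rule_tac continuous_map_extend_zero[of _ "r ` U"]) (auto simp: eq act_outside)
  then show ?thesis using U by (simp add: D_iff act_outside)
qed

lemma act_inv_act:
  assumes U: "U \<in> cob" and f: "f \<in> D (iv ` U)"
  shows "act (iv ` U) (act U f) = f"
proof (rule act_eqI[OF cob_inv[OF U]])
  fix v assume "v \<in> iv ` U"
  then obtain u where "u \<in> U" "v = iv u" "u \<in> arrows G" using cob_arrows[OF U] by auto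
  then show "act U f (d v) = f (r v)" using U by (simp add: d_inv r_inv act_r)
next
  fix x assume "x \<notin> r ` iv ` U"
  then show "f x = 0" using f cob_inv[OF U] by (simp add: D_iff)
qed

lemma act_act_inv:
  assumes U: "U \<in> cob" and f: "f \<in> D U"
  shows "act U (act (iv ` U) f) = f"
  using act_inv_act[OF cob_inv[OF U]] f iv_iv_image[OF cob_arrows[OF U]] by simp

lemma D_inv_iff:
  assumes U: "U \<in> cob" and f: "f \<in> carrier A"
  shows "f \<in> D (iv ` U) \<longleftrightarrow> (\<forall>x. x \<notin> d ` U \<longrightarrow> f x = 0)"
  using D_iff[OF cob_inv[OF U]] carrier_A_continuous[OF f] r_iv_image[OF cob_arrows[OF U]] by simp

text \<open>The value of \<open>act V f\<close> at \<open>r v\<close> is \<open>f (d v)\<close>. So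
  \<open>act V f\<close> vanishes off the domain of \<open>U\<close> iff \<open>f\<close> vanishes
  at \<open>d v\<close> whenever \<open>r v\<close> is outside it, and by
  \<open>d_image_setmult\<close> these \<open>d v\<close> are the points of the domain of
  \<open>V\<close> outside that of \<open>U \<odot> V\<close>.\<close>

lemma act_domain:
  assumes U: "U \<in> cob" and V: "V \<in> cob"
  shows "{f \<in> D (iv ` V). act V f \<in> D (iv ` U)} = D (iv ` (U \<odot> V))"
proof (intro equalityI subsetI)
  note a = cob_arrows[OF U] cob_arrows[OF V]
  note UV = cob_setmult[OF U V]
  { fix f assume "f \<in> {f \<in> D (iv ` V). act V f \<in> D (iv ` U)}"
    then have f: "f \<in> D (iv ` V)" "act V f \<in> D (iv ` U)" "f \<in> carrier A" "act V f \<in> carrier A"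
      using D_carrier by auto
    have "f x = 0" if x: "x \<notin> d ` (U \<odot> V)" for x
    proof (cases "x \<in> d ` V")
      case True
      then obtain v where v: "v \<in> V" "x = d v" by auto
      then have "r v \<notin> d ` U" using x a by (auto simp: d_image_setmult)
      then have "act V f (r v) = 0" using f D_inv_iff[OF U] by simp
      then show ?thesis using v V by (simp add: act_r)
    qed (use f D_inv_iff[OF V] in simp)
    then show "f \<in> D (iv ` (U \<odot> V))" using f D_inv_iff[OF UV] by simp }
  { fix f assume "f \<in> D (iv ` (U \<odot> V))"
    then have f: "f \<in> carrier A" "\<And>x. x \<notin> d ` (U \<odot> V) \<Longrightarrow> f x = 0"
      using D_inv_iff[OF UV] D_carrier by auto
    have "f x = 0" if "x \<notin> d ` V" for x
      by (rule f(2)) (use that a in \<open>auto simp: d_image_setmult\<close>)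
    then have "f \<in> D (iv ` V)" using f(1) D_inv_iff[OF V] by simp
    moreover have "act V f x = 0" if x: "x \<notin> d ` U" for x
    proof (cases "x \<in> r ` V")
      case True
      then obtain v where v: "v \<in> V" "x = r v" by auto
      \<comment> \<open>By injectivity of \<open>d\<close> on \<open>V\<close>, no other arrow of
        \<open>V\<close> with range in the domain of \<open>U\<close> can have domain
        \<open>d v\<close>.\<close>
      then have "d v \<notin> d ` (U \<odot> V)" using x bisection_d_eq[OF cob_bisection[OF V]]
        unfolding d_image_setmult[OF a] by (smt (verit) mem_Collect_eq)
      then show ?thesis using v V f by (simp add: act_r)
    qed (simp add: act_outside)
    then have "act V f \<in> D (iv ` U)" using D_inv_iff[OF U] act_closed[OF V f(1)] D_carrier by blast
    ultimately show "f \<in> {f \<in> D (iv ` V). act V f \<in> D (iv ` U)}" by simp }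
qed

text \<open>This holds for every \<open>f\<close>, since both sides vanish off the range of
  \<open>U \<odot> V\<close>; inside, both equal \<open>f (d v)\<close> at
  \<open>r (u \<cdot> v)\<close>.\<close>

lemma act_setmult:
  assumes U: "U \<in> cob" and V: "V \<in> cob"
  shows "act (U \<odot> V) f = act U (act V f)"
proof (rule act_eqI[OF cob_setmult[OF U V]])
  note a = cob_arrows[OF U] cob_arrows[OF V]
  fix x assume "x \<in> U \<odot> V"
  then obtain u v where "u \<in> U" "v \<in> V" "d u = r v" "r x = r u" "d x = d v"
    using setmultD[OF _ a] by blast
  then show "f (d x) = act U (act V f) (r x)" using U V by (simp add: act_r)
next
  fix x assume x: "x \<notin> r ` (U \<odot> V)"
  note a = cob_arrows[OF U] cob_arrows[OF V]
  show "act U (act V f) x = 0"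
  proof (cases "x \<in> r ` U")
    case True
    then obtain u where u: "u \<in> U" "x = r u" by auto
    have "d u \<notin> r ` V"
    proof
      assume "d u \<in> r ` V"
      then obtain v where "v \<in> V" "d u = r v" by auto
      then have "u \<cdot> v \<in> U \<odot> V" "r (u \<cdot> v) = x" using u a by (auto intro: setmultI simp: r_mult subset_iff)
      then show False using x by blast
    qed
    then show ?thesis using u U by (simp add: act_r act_outside)
  qed (simp add: act_outside)
qed

lemma act_bij:
  assumes U: "U \<in> cob"
  shows "bij_betw (act U) (D (iv ` U)) (D U)"
  by (rule bij_betw_byWitness[of _ "act (iv ` U)"])
    (use U cob_inv[OF U] in \<open>auto simp: act_inv_act act_act_inv act_closed D_carrier\<close>)

lemma spectral_action_B: "spectral_action B A D act"
proof -
  interpret S: inverse_semigroup B by (rule inverse_semigroup_B)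
  interpret A: nonunital_ring A by (rule nonunital_ring_A)
  show ?thesis
  proof
    fix U assume "U \<in> carrier B"
    then have U: "U \<in> cob" by simp
    show "two_sided_ideal (D U) A" by (rule two_sided_ideal_D[OF U])
    show "has_local_units A (D U)"
      unfolding has_local_units_def
    \<comment> \<open>A single local unit serves all finite subsets at once.\<close>
    proof (intro allI impI bexI[of _ "chi U"] conjI ballI)
      show "chi U \<in> D U" by (rule chi_D[OF U])
    qed (use chi_D[OF U] in \<open>auto simp: chi_mult[OF U] chi_mult_right[OF U] subset_iff\<close>)
    show "bij_betw (act U) (D (star B U)) (D U)" using act_bij[OF U] by simp
    show "act U (f \<oplus>\<^bsub>A\<^esub> g) = act U f \<oplus>\<^bsub>A\<^esub> act U g" for f g
      using U by (intro act_eqI) (auto simp: act_r act_outside)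
    show "act U (f \<otimes>\<^bsub>A\<^esub> g) = act U f \<otimes>\<^bsub>A\<^esub> act U g" for f g
      using U by (intro act_eqI) (auto simp: act_r act_outside)
    fix V assume "V \<in> carrier B"
    then have V: "V \<in> cob" by simp
    show "{f \<in> D (star B V). act V f \<in> D (star B U)} = D (star B (U \<otimes>\<^bsub>B\<^esub> V))"
      using act_domain[OF U V] by simp
    show "act (U \<otimes>\<^bsub>B\<^esub> V) f = act U (act V f)" for f
      using act_setmult[OF U V] by simp
  next
    fix E assume "E \<in> idempotents B"
    then have "E \<in> cob" by (simp add: idempotents_B)
    then show "has_unit_element A (D E)"
      unfolding has_unit_element_def
      by (intro bexI[of _ "chi E"]) (simp_all add: chi_mult chi_mult_right chi_D)
  next
    let ?S = "{finsum A x F | F x. finite F \<and> F \<subseteq> idempotents B \<and> x \<in> (\<Pi> e\<in>F. D e)}"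
    show "?S = carrier A"
    proof (intro equalityI subsetI)
      fix f assume "f \<in> ?S"
      then show "f \<in> carrier A" using D_carrier by (auto intro!: A.finsum_closed)
    next
      fix f assume f: "f \<in> carrier A"
      then obtain K where K: "K \<in> idempotents B" "f \<in> D K" using carrier_A by blast
      \<comment> \<open>One summand suffices because \<open>f\<close> already lies in some
        \<open>D K\<close> with \<open>K\<close> idempotent.\<close>
      then have "f = finsum A (\<lambda>_. f) {K}" using f by (simp add: finsum_A)
      then show "f \<in> ?S" using K by (intro CollectI exI[of _ "{K}"] exI[of _ "\<lambda>_. f"]) auto
    qed
  qed
qed

end

section \<open>The first isomorphism theorem for non-unital rings\<close>

text \<open>Only the operations of \<open>T\<close> are given, none of its axioms; this fits a
  quotient of a possibly non-associative structure. The zero is a separate record field and has to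
  be matched separately.\<close>

lemma nonunital_ring_transport:
  fixes S (structure)
  assumes S: "nonunital_ring S" and bij: "bij_betw h (carrier S) (carrier T)"
    and add: "\<And>x y. x \<in> carrier S \<Longrightarrow> y \<in> carrier S \<Longrightarrow> h (x \<oplus> y) = h x \<oplus>\<^bsub>T\<^esub> h y"
    and mult: "\<And>x y. x \<in> carrier S \<Longrightarrow> y \<in> carrier S \<Longrightarrow> h (x \<otimes> y) = h x \<otimes>\<^bsub>T\<^esub> h y"
    and zero: "h \<zero> = \<zero>\<^bsub>T\<^esub>"
  shows "nonunital_ring T"
proof -
  interpret S: nonunital_ring S by (rule S)
  have T: "carrier T = h ` carrier S" using bij by (simp add: bij_betw_def)
  note simps = add[symmetric] mult[symmetric] zero[symmetric]
  have "abelian_group T"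
  proof (rule abelian_groupI)
    show "\<exists>y\<in>carrier T. y \<oplus>\<^bsub>T\<^esub> x = \<zero>\<^bsub>T\<^esub>" if x: "x \<in> carrier T" for x
    proof -
      obtain a where a: "a \<in> carrier S" "x = h a" using x T by auto
      then have "h (\<ominus> a) \<oplus>\<^bsub>T\<^esub> x = \<zero>\<^bsub>T\<^esub>" by (simp add: simps S.l_neg)
      then show ?thesis using a T by blast
    qed
  qed (auto simp: T simps S.a_ac)
  then show ?thesis
    by (intro nonunital_ring.intro nonunital_ring_axioms.intro)
      (auto simp: T simps S.mult_closed S.mult_assoc S.distrib_left S.distrib_right)
qed

text \<open>The isomorphism sends an element of \<open>S\<close> to its fibre under \<open>h\<close>, which is a coset of the
  kernel.\<close>

lemma ring_isomorphic_FactRing_kernel: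
  fixes R (structure)
  assumes R: "abelian_group R" and S: "nonunital_ring S"
    and mult_closed: "\<And>x y. x \<in> carrier R \<Longrightarrow> y \<in> carrier R \<Longrightarrow> x \<otimes> y \<in> carrier R"
    and surj: "h ` carrier R = carrier S"
    and add: "\<And>x y. x \<in> carrier R \<Longrightarrow> y \<in> carrier R \<Longrightarrow> h (x \<oplus> y) = h x \<oplus>\<^bsub>S\<^esub> h y"
    and mult: "\<And>x y. x \<in> carrier R \<Longrightarrow> y \<in> carrier R \<Longrightarrow> h (x \<otimes> y) = h x \<otimes>\<^bsub>S\<^esub> h y"
    and K: "K = {x \<in> carrier R. h x = \<zero>\<^bsub>S\<^esub>}"
  shows "ring_isomorphic S (R Quot K)"
proof -
  interpret R: abelian_group R by (rule R)
  interpret S: nonunital_ring S by (rule S)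
  let ?fib = "\<lambda>s. {x \<in> carrier R. h x = s}"
  have hS: "h x \<in> carrier S" if "x \<in> carrier R" for x using that surj by blast
  have coset: "K +> a = ?fib (h a)" if a: "a \<in> carrier R" for a
  proof (intro equalityI subsetI)
    fix x assume "x \<in> K +> a"
    then show "x \<in> ?fib (h a)" using a by (auto simp: K a_r_coset_def' add hS)
  next
    fix x assume x: "x \<in> ?fib (h a)"
    then have xa: "x = (x \<ominus> a) \<oplus> a" using a by (simp add: R.minus_eq R.a_assoc R.l_neg)
    have c: "x \<ominus> a \<in> carrier R" using x a by simp
    \<comment> \<open>\<open>h\<close> is only known to be additive, so its value at the difference
      is obtained by cancelling \<open>h a\<close> in \<open>S\<close>.\<close>
    have "h (x \<ominus> a) \<oplus>\<^bsub>S\<^esub> h a = \<zero>\<^bsub>S\<^esub> \<oplus>\<^bsub>S\<^esub> h a"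
      using x xa a c add[OF c a] by (simp add: hS)
    then have "h (x \<ominus> a) = \<zero>\<^bsub>S\<^esub>" using a c hS S.add.right_cancel by simp
    then show "x \<in> K +> a" using xa c by (auto simp: K a_r_coset_def')
  qed
  have Q: "carrier (R Quot K) = ?fib ` carrier S"
    unfolding FactRing_def A_RCOSETS_def' using coset surj by (auto simp: image_iff)
  have bij: "bij_betw ?fib (carrier S) (carrier (R Quot K))"
  proof (rule bij_betw_imageI)
    show "inj_on ?fib (carrier S)"
    proof (rule inj_onI)
      fix s t assume s: "s \<in> carrier S" and eq: "?fib s = ?fib t"
      obtain a where "a \<in> carrier R" "h a = s" using s surj by (metis imageE)
      then have "a \<in> ?fib t" using eq by auto
      then show "s = t" using \<open>h a = s\<close> by simp
    qed
  qed (simp add: Q)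
  have add': "?fib (s \<oplus>\<^bsub>S\<^esub> t) = ?fib s \<oplus>\<^bsub>R Quot K\<^esub> ?fib t" if st: "s \<in> carrier S" "t \<in> carrier S" for s t
  proof -
    obtain a b where ab: "a \<in> carrier R" "b \<in> carrier R" "s = h a" "t = h b" using st surj by blast
    have "set_add R (?fib (h a)) (?fib (h b)) = ?fib (h a \<oplus>\<^bsub>S\<^esub> h b)"
    proof (intro equalityI subsetI)
      fix x assume "x \<in> set_add R (?fib (h a)) (?fib (h b))"
      then show "x \<in> ?fib (h a \<oplus>\<^bsub>S\<^esub> h b)" by (auto simp: set_add_def' add)
    next
      fix x assume "x \<in> ?fib (h a \<oplus>\<^bsub>S\<^esub> h b)"
      then have "x \<in> K +> (a \<oplus> b)" using ab coset[of "a \<oplus> b"] by (simp add: add)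
      then obtain k where k: "k \<in> K" "x = k \<oplus> (a \<oplus> b)" by (auto simp: a_r_coset_def')
      then have "x = (k \<oplus> a) \<oplus> b" "k \<oplus> a \<in> K +> a" using ab by (auto simp: K R.a_assoc a_r_coset_def')
      then show "x \<in> set_add R (?fib (h a)) (?fib (h b))" using ab coset[of a] by (auto simp: set_add_def')
    qed
    then show ?thesis using ab by (simp add: FactRing_def)
  qed
  have mult': "?fib (s \<otimes>\<^bsub>S\<^esub> t) = ?fib s \<otimes>\<^bsub>R Quot K\<^esub> ?fib t" if st: "s \<in> carrier S" "t \<in> carrier S" for s t
  proof -
    obtain a b where ab: "a \<in> carrier R" "b \<in> carrier R" "s = h a" "t = h b" using st surj by blast
    \<comment> \<open>The product of two cosets is a union over all representatives. By
      multiplicativity of \<open>h\<close> every member of this nonempty family is the same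
      fibre.\<close>
    have "K +> (x \<otimes> y) = ?fib (s \<otimes>\<^bsub>S\<^esub> t)" if "x \<in> ?fib s" "y \<in> ?fib t" for x y
      using that by (simp add: coset mult_closed mult)
    then have "(\<Union>x\<in>?fib s. \<Union>y\<in>?fib t. K +> (x \<otimes> y)) = (\<Union>x\<in>?fib s. \<Union>y\<in>?fib t. ?fib (s \<otimes>\<^bsub>S\<^esub> t))"
      by (intro SUP_cong refl)
    also have "\<dots> = ?fib (s \<otimes>\<^bsub>S\<^esub> t)" using ab by blast
    finally show ?thesis by (simp add: FactRing_def rcoset_mult_def)
  qed
  \<comment> \<open>\<open>R\<close> carries no associativity or distributivity, so the axioms of
    the quotient are carried over from \<open>S\<close>.\<close>
  have "?fib \<zero>\<^bsub>S\<^esub> = \<zero>\<^bsub>R Quot K\<^esub>" by (simp add: FactRing_def K)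
  then have "nonunital_ring (R Quot K)"
    using nonunital_ring_transport[OF S bij add' mult'] by blast
  then show ?thesis unfolding ring_isomorphic_def using S bij add' mult' by blast
qed

section \<open>The convolution product\<close>

context groupoid
begin

text \<open>Finite support in each range fibre makes every convolution sum finite and survives
  addition and convolution, so the ring laws can be proved without topology.\<close>

definition row_finite :: "(_ \<Rightarrow> complex) \<Rightarrow> bool" where
  "row_finite f \<longleftrightarrow> (\<forall>x. x \<notin> arrows G \<longrightarrow> f x = 0) \<and> (\<forall>y. finite {x \<in> arrows G. r x = y \<and> f x \<noteq> 0})"

abbreviation conv where "conv \<equiv> convolution G"

lemma conv_outside: "x \<notin> arrows G \<Longrightarrow> conv f g x = 0"
proof -
  assume "x \<notin> arrows G"
  then have "{(b, c). (b, c) \<in> composable G \<and> b \<cdot> c = x \<and> f b \<noteq> 0 \<and> g c \<noteq> 0} = {}"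
    using mult_closed by auto
  then show ?thesis unfolding convolution_def by (simp only: sum.empty)
qed

text \<open>A factorisation of \<open>x\<close> is determined by its left factor \<open>b\<close>,
  the right one being \<open>iv b \<cdot> x\<close>. The freedom in \<open>P\<close> lets several
  functions share one index set.\<close>

lemma conv_eq_sum:
  assumes x: "x \<in> arrows G" and P: "finite P" "P \<subseteq> {b \<in> arrows G. r b = r x}"
    and supp: "{b \<in> arrows G. r b = r x \<and> f b \<noteq> 0} \<subseteq> P"
    and g: "\<And>y. y \<notin> arrows G \<Longrightarrow> g y = 0"
  shows "conv f g x = (\<Sum>b\<in>P. f b * g (iv b \<cdot> x))"
proof -
  let ?I = "{(b, c). (b, c) \<in> composable G \<and> b \<cdot> c = x \<and> f b \<noteq> 0 \<and> g c \<noteq> 0}"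
  let ?J = "{b \<in> P. f b \<noteq> 0 \<and> g (iv b \<cdot> x) \<noteq> 0}"
  have I: "b \<in> arrows G" "c \<in> arrows G" "r b = r x" "c = iv b \<cdot> x" if "(b, c) \<in> ?I" for b c
    using that by (auto simp: composable_def r_mult inv_cancel)
  have J: "(b, iv b \<cdot> x) \<in> composable G" "b \<cdot> (iv b \<cdot> x) = x" if "b \<in> P" for b
  proof -
    have b: "b \<in> arrows G" "r b = r x" using that P by auto
    then show "b \<cdot> (iv b \<cdot> x) = x" using x by (simp add: cancel_inv)
    show "(b, iv b \<cdot> x) \<in> composable G"
      using b x by (intro composableI) (simp_all add: mult_closed' inv_closed d_inv r_mult r_inv)
  qed
  have "conv f g x = (\<Sum>(b, c)\<in>?I. f b * g c)" by (simp add: convolution_def)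
  also have "\<dots> = (\<Sum>b\<in>?J. f b * g (iv b \<cdot> x))"
  proof (rule sum.reindex_bij_witness[of _ "\<lambda>b. (b, iv b \<cdot> x)" fst])
    fix p assume p: "p \<in> ?I"
    obtain b c where bc: "p = (b, c)" by (cases p)
    have "b \<in> P" using supp I[of b c] p unfolding bc by auto
    then show "fst p \<in> ?J" using p I[of b c] unfolding bc by auto
    show "(fst p, iv (fst p) \<cdot> x) = p" using p I[of b c] unfolding bc by auto
    show "f (fst p) * g (iv (fst p) \<cdot> x) = (case p of (b, c) \<Rightarrow> f b * g c)"
      using p I[of b c] unfolding bc by auto
  qed (use J in auto)
  also have "\<dots> = (\<Sum>b\<in>P. f b * g (iv b \<cdot> x))"
    using P by (intro sum.mono_neutral_left) auto
  finally show ?thesis .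
qed

lemma row_finite_conv_eq:
  assumes "row_finite f" "row_finite g" "x \<in> arrows G" "finite P" "P \<subseteq> {b \<in> arrows G. r b = r x}"
    and "{b \<in> arrows G. r b = r x \<and> f b \<noteq> 0} \<subseteq> P"
  shows "conv f g x = (\<Sum>b\<in>P. f b * g (iv b \<cdot> x))"
  using assms by (intro conv_eq_sum) (auto simp: row_finite_def)

lemma row_finite_add:
  assumes "row_finite f" "row_finite g"
  shows "row_finite (\<lambda>x. f x + g x)"
proof -
  have "finite {x \<in> arrows G. r x = y \<and> f x + g x \<noteq> 0}" for y
    by (rule finite_subset[of _ "{x \<in> arrows G. r x = y \<and> f x \<noteq> 0} \<union> {x \<in> arrows G. r x = y \<and> g x \<noteq> 0}"])
      (use assms in \<open>auto simp: row_finite_def\<close>)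
  then show ?thesis using assms by (simp add: row_finite_def)
qed

lemma conv_add_left:
  assumes "row_finite f" "row_finite g" "row_finite k"
  shows "conv (\<lambda>x. f x + g x) k = (\<lambda>x. conv f k x + conv g k x)"
proof
  fix x show "conv (\<lambda>x. f x + g x) k x = conv f k x + conv g k x"
  proof (cases "x \<in> arrows G")
    case True
    let ?P = "{b \<in> arrows G. r b = r x \<and> f b \<noteq> 0} \<union> {b \<in> arrows G. r b = r x \<and> g b \<noteq> 0}"
    have P: "finite ?P" "?P \<subseteq> {b \<in> arrows G. r b = r x}" using assms by (auto simp: row_finite_def)
    note eq = row_finite_conv_eq[OF _ assms(3) True P]
    have "conv f k x = (\<Sum>b\<in>?P. f b * k (iv b \<cdot> x))" "conv g k x = (\<Sum>b\<in>?P. g b * k (iv b \<cdot> x))"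
      "conv (\<lambda>x. f x + g x) k x = (\<Sum>b\<in>?P. (f b + g b) * k (iv b \<cdot> x))"
      using assms row_finite_add by (intro eq; force)+
    then show ?thesis by (simp add: distrib_right sum.distrib)
  qed (simp add: conv_outside)
qed

lemma conv_add_right:
  assumes "row_finite f" "row_finite g" "row_finite k"
  shows "conv k (\<lambda>x. f x + g x) = (\<lambda>x. conv k f x + conv k g x)"
proof
  fix x show "conv k (\<lambda>x. f x + g x) x = conv k f x + conv k g x"
  proof (cases "x \<in> arrows G")
    case True
    let ?P = "{b \<in> arrows G. r b = r x \<and> k b \<noteq> 0}"
    have P: "finite ?P" "?P \<subseteq> {b \<in> arrows G. r b = r x}" using assms by (auto simp: row_finite_def)
    note eq = row_finite_conv_eq[OF assms(3) _ True P order.refl]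
    show ?thesis using assms row_finite_add[of f g] by (simp add: eq distrib_left sum.distrib)
  qed (simp add: conv_outside)
qed

text \<open>A nonzero value at \<open>x\<close> forces \<open>x = b \<cdot> c\<close> with
  \<open>b\<close> in the support of \<open>f\<close> over \<open>y\<close> and \<open>c\<close> in
  the support of \<open>g\<close> over \<open>d b\<close>: finitely many choices each.\<close>

lemma row_finite_conv:
  assumes f: "row_finite f" and g: "row_finite g"
  shows "row_finite (conv f g)"
proof -
  have "finite {x \<in> arrows G. r x = y \<and> conv f g x \<noteq> 0}" for y
  proof -
    let ?R = "{b \<in> arrows G. r b = y \<and> f b \<noteq> 0}"
    let ?S = "\<lambda>b. {c \<in> arrows G. r c = d b \<and> g c \<noteq> 0}"
    have "{x \<in> arrows G. r x = y \<and> conv f g x \<noteq> 0} \<subseteq> (\<Union>b\<in>?R. (\<lambda>c. b \<cdot> c) ` ?S b)"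
    proof
      fix x assume x: "x \<in> {x \<in> arrows G. r x = y \<and> conv f g x \<noteq> 0}"
      let ?P = "{b \<in> arrows G. r b = r x \<and> f b \<noteq> 0}"
      have "conv f g x = (\<Sum>b\<in>?P. f b * g (iv b \<cdot> x))"
        using f x by (intro row_finite_conv_eq[OF f g]) (auto simp: row_finite_def)
      then obtain b where b: "b \<in> ?P" "f b * g (iv b \<cdot> x) \<noteq> 0"
        using x by (auto elim: sum.not_neutral_contains_not_neutral)
      then have "iv b \<cdot> x \<in> ?S b" "x = b \<cdot> (iv b \<cdot> x)" using x
        by (auto simp: mult_closed' inv_closed d_inv r_mult r_inv cancel_inv)
      then show "x \<in> (\<Union>b\<in>?R. (\<lambda>c. b \<cdot> c) ` ?S b)" using b x by blast
    qed
    moreover have "finite (\<Union>b\<in>?R. (\<lambda>c. b \<cdot> c) ` ?S b)"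
      using f g by (auto simp: row_finite_def)
    ultimately show ?thesis using finite_subset by blast
  qed
  then show ?thesis by (simp add: row_finite_def conv_outside)
qed

text \<open>Both sides are the double sum of
  \<open>f b * g (iv b \<cdot> p) * k (iv p \<cdot> x)\<close> over left factors \<open>b\<close>
  and partial products \<open>p = b \<cdot> c\<close>.\<close>

lemma conv_assoc:
  assumes f: "row_finite f" and g: "row_finite g" and k: "row_finite k"
  shows "conv (conv f g) k = conv f (conv g k)"
proof
  fix x show "conv (conv f g) k x = conv f (conv g k) x"
  proof (cases "x \<in> arrows G")
    case x: True
    let ?R = "{b \<in> arrows G. r b = r x \<and> f b \<noteq> 0}"
    let ?S = "\<lambda>b. {c \<in> arrows G. r c = d b \<and> g c \<noteq> 0}"
    \<comment> \<open>The products \<open>b \<cdot> c\<close> make the translates of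
      \<open>?P\<close> cover the support of \<open>g\<close>; the second set makes
      \<open>?P\<close> cover the support of \<open>conv f g\<close>.\<close>
    let ?P = "(\<Union>b\<in>?R. (\<lambda>c. b \<cdot> c) ` ?S b) \<union> {b \<in> arrows G. r b = r x \<and> conv f g b \<noteq> 0}"
    have finR: "finite ?R" using f by (simp add: row_finite_def)
    have finP: "finite ?P" using f g row_finite_conv[OF f g] by (auto simp: row_finite_def)
    have subP: "?P \<subseteq> {b \<in> arrows G. r b = r x}" by (auto simp: mult_closed' r_mult)
    have "conv (conv f g) k x = (\<Sum>p\<in>?P. conv f g p * k (iv p \<cdot> x))"
      using row_finite_conv[OF f g] k x finP subP by (intro row_finite_conv_eq) auto
    also have "\<dots> = (\<Sum>p\<in>?P. \<Sum>b\<in>?R. f b * g (iv b \<cdot> p) * k (iv p \<cdot> x))"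
    proof (rule sum.cong[OF refl])
      fix p assume "p \<in> ?P"
      then have "p \<in> arrows G" "r p = r x" using subP by auto
      then have "conv f g p = (\<Sum>b\<in>?R. f b * g (iv b \<cdot> p))"
        using finR by (intro row_finite_conv_eq[OF f g]) auto
      then show "conv f g p * k (iv p \<cdot> x) = (\<Sum>b\<in>?R. f b * g (iv b \<cdot> p) * k (iv p \<cdot> x))"
        by (simp add: sum_distrib_right)
    qed
    also have "\<dots> = (\<Sum>b\<in>?R. f b * (\<Sum>p\<in>?P. g (iv b \<cdot> p) * k (iv p \<cdot> x)))"
      unfolding sum_distrib_left mult.assoc by (rule sum.swap)
    also have "\<dots> = (\<Sum>b\<in>?R. f b * conv g k (iv b \<cdot> x))"
    proof (rule sum.cong[OF refl])
      fix b assume b: "b \<in> ?R"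
      \<comment> \<open>Left translation by \<open>iv b\<close> is injective on the range fibre of
        \<open>x\<close> and turns the sum over \<open>p\<close> into the sum defining
        \<open>conv g k\<close> at \<open>iv b \<cdot> x\<close>.\<close>
      let ?Q = "(\<lambda>p. iv b \<cdot> p) ` ?P"
      have ibx: "iv b \<cdot> x \<in> arrows G" "r (iv b \<cdot> x) = d b"
        using b x by (auto simp: mult_closed' inv_closed d_inv r_mult r_inv)
      have inj: "inj_on (\<lambda>p. iv b \<cdot> p) ?P"
      proof (rule inj_onI)
        fix p q assume "p \<in> ?P" "q \<in> ?P" and eq: "iv b \<cdot> p = iv b \<cdot> q"
        then have "p \<in> arrows G" "r p = r x" "q \<in> arrows G" "r q = r x" using subP by blast+
        then have "b \<cdot> (iv b \<cdot> p) = p" "b \<cdot> (iv b \<cdot> q) = q" using b by (auto intro!: cancel_inv)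
        then show "p = q" using eq by metis
      qed
      have subQ: "?Q \<subseteq> {c \<in> arrows G. r c = r (iv b \<cdot> x)}"
      proof
        fix q assume "q \<in> ?Q"
        then obtain p where "q = iv b \<cdot> p" "p \<in> arrows G" "r p = r x" using subP by blast
        then show "q \<in> {c \<in> arrows G. r c = r (iv b \<cdot> x)}"
          unfolding ibx using b by (auto simp: mult_closed' inv_closed d_inv r_mult r_inv)
      qed
      have supQ: "{c \<in> arrows G. r c = r (iv b \<cdot> x) \<and> g c \<noteq> 0} \<subseteq> ?Q"
      proof
        fix c assume "c \<in> {c \<in> arrows G. r c = r (iv b \<cdot> x) \<and> g c \<noteq> 0}"
        then have c: "c \<in> ?S b" unfolding ibx by auto
        then have "b \<cdot> c \<in> ?P" using b by blast
        moreover have "c = iv b \<cdot> (b \<cdot> c)" using b c by (simp add: inv_cancel)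
        ultimately show "c \<in> ?Q" by blast
      qed
      have "conv g k (iv b \<cdot> x) = (\<Sum>q\<in>?Q. g q * k (iv q \<cdot> (iv b \<cdot> x)))"
        using finP ibx subQ supQ by (intro row_finite_conv_eq[OF g k]) auto
      also have "\<dots> = (\<Sum>p\<in>?P. g (iv b \<cdot> p) * k (iv (iv b \<cdot> p) \<cdot> (iv b \<cdot> x)))"
        using inj by (simp add: sum.reindex)
      also have "\<dots> = (\<Sum>p\<in>?P. g (iv b \<cdot> p) * k (iv p \<cdot> x))"
      proof (rule sum.cong[OF refl])
        fix p assume "p \<in> ?P"
        then have p: "p \<in> arrows G" "r p = r x" using subP by auto
        have bp: "iv b \<cdot> p \<in> arrows G" "r (iv b \<cdot> p) = d b" "d (iv b \<cdot> p) = d p"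
          using b p by (auto simp: mult_closed' inv_closed d_inv r_mult d_mult r_inv)
        have ipx: "iv p \<cdot> x \<in> arrows G" "r (iv p \<cdot> x) = d p"
          using p x by (auto simp: mult_closed' inv_closed d_inv r_mult r_inv)
        have "(iv b \<cdot> p) \<cdot> (iv p \<cdot> x) = iv b \<cdot> (p \<cdot> (iv p \<cdot> x))"
          using b p ipx by (intro mult_assoc') (auto simp: inv_closed d_inv)
        also have "\<dots> = iv b \<cdot> x" using p x by (simp add: cancel_inv)
        finally have "iv (iv b \<cdot> p) \<cdot> (iv b \<cdot> x) = iv p \<cdot> x"
          using inv_cancel[of "iv b \<cdot> p" "iv p \<cdot> x"] bp ipx by simp
        then show "g (iv b \<cdot> p) * k (iv (iv b \<cdot> p) \<cdot> (iv b \<cdot> x)) = g (iv b \<cdot> p) * k (iv p \<cdot> x)"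
          by simp
      qed
      finally show "f b * (\<Sum>p\<in>?P. g (iv b \<cdot> p) * k (iv p \<cdot> x)) = f b * conv g k (iv b \<cdot> x)" by simp
    qed
    also have "\<dots> = conv f (conv g k) x"
      using row_finite_conv[OF g k] x finR by (intro row_finite_conv_eq[OF f, symmetric]) auto
    finally show ?thesis .
  qed (simp add: conv_outside)
qed

end

section \<open>The skew ring and the groupoid algebra\<close>

lemma ideal_generated_mono:
  assumes "two_sided_ideal I R" "X \<subseteq> I"
  shows "ideal_generated R X \<subseteq> I"
  using assms by (auto simp: ideal_generated_def)

context hausdorff_ample_groupoid
begin

abbreviation L where "L \<equiv> skew_sum A B D act"
abbreviation N where "N \<equiv> skew_relations A B D act"
abbreviation C where "C \<equiv> Cc_groupoid G"
abbreviation dl where "dl \<equiv> delta A"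
text \<open>The support of a formal sum, a set of bisections, as opposed to the topological
  \<open>unit_support\<close>.\<close>

abbreviation supp where "supp \<phi> \<equiv> {U. \<phi> U \<noteq> (\<lambda>x. 0 :: complex)}"

lemma C_simps [simp]:
  "zero C = (\<lambda>x. 0)" "add C f g = (\<lambda>x. f x + g x)" "mult C f g = conv f g"
  "carrier C = groupoid_functions G"
  by (simp_all add: Cc_groupoid_def)

lemma L_simps [simp]:
  "zero L = (\<lambda>U x. 0)" "add L \<phi> \<psi> = (\<lambda>U x. \<phi> U x + \<psi> U x)"
  by (simp_all add: skew_sum_def)

lemma carrier_L:
  "\<phi> \<in> carrier L \<longleftrightarrow> (\<forall>U\<in>cob. \<phi> U \<in> D U) \<and> (\<forall>U. U \<notin> cob \<longrightarrow> \<phi> U = (\<lambda>x. 0)) \<and> finite (supp \<phi>)"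
  by (simp add: skew_sum_def)

lemma delta_apply: "dl a U V = (if V = U then a else (\<lambda>x. 0))"
  by (auto simp: delta_def)

lemma L_add:
  assumes "\<phi> \<in> carrier L" "\<psi> \<in> carrier L"
  shows "(\<lambda>U x. \<phi> U x + \<psi> U x) \<in> carrier L"
proof -
  have "finite (supp (\<lambda>U x. \<phi> U x + \<psi> U x))"
    by (rule finite_subset[of _ "supp \<phi> \<union> supp \<psi>"]) (use assms in \<open>auto simp: carrier_L\<close>)
  then show ?thesis using assms by (simp add: carrier_L D_add)
qed

lemma L_minus: "\<phi> \<in> carrier L \<Longrightarrow> (\<lambda>U x. - \<phi> U x) \<in> carrier L"
  by (simp add: carrier_L D_minus fun_eq_iff)

lemma L_delta: "U \<in> cob \<Longrightarrow> a \<in> D U \<Longrightarrow> dl a U \<in> carrier L"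
  by (auto simp: carrier_L delta_apply D_zero intro: finite_subset[of _ "{U}"])

lemma abelian_group_L: "abelian_group L"
proof (rule abelian_groupI)
  show "\<zero>\<^bsub>L\<^esub> \<in> carrier L" by (simp add: carrier_L D_zero)
  show "\<exists>\<psi>\<in>carrier L. \<psi> \<oplus>\<^bsub>L\<^esub> \<phi> = \<zero>\<^bsub>L\<^esub>" if "\<phi> \<in> carrier L" for \<phi>
    using L_minus[OF that] by (intro bexI[of _ "\<lambda>U x. - \<phi> U x"]) auto
qed (auto simp: L_add ac_simps)

lemma a_inv_L: "\<phi> \<in> carrier L \<Longrightarrow> a_inv L \<phi> = (\<lambda>U x. - \<phi> U x)"
  using abelian_group.minus_equality[OF abelian_group_L] L_minus by simp

lemma a_minus_L:
  "\<phi> \<in> carrier L \<Longrightarrow> \<psi> \<in> carrier L \<Longrightarrow> a_minus L \<phi> \<psi> = (\<lambda>U x. \<phi> U x - \<psi> U x)"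
  by (simp add: a_minus_def a_inv_L)

subsection \<open>Products in the skew ring\<close>

text \<open>The coefficient of the product of \<open>a \<delta>\<close> at \<open>U\<close> with
  \<open>b \<delta>\<close> at any \<open>V\<close>; the formula does not involve
  \<open>V\<close>.\<close>

definition twist where
  "twist U a b = act U (\<lambda>x. act (iv ` U) a x * b x)"

text \<open>The two actions cancel on \<open>a\<close>, while \<open>b\<close> is moved from
  \<open>d u\<close> to \<open>r u\<close>. The result is the shape of a single convolution
  term.\<close>

lemma twist_r:
  assumes "U \<in> cob" "u \<in> U"
  shows "twist U a b (r u) = a (r u) * b (d u)"
proof -
  have "act (iv ` U) a (r (iv u)) = a (d (iv u))" using assms by (intro act_r cob_inv) auto
  moreover have "u \<in> arrows G" using assms cob_arrows by auto
  ultimately show ?thesis using assms by (simp add: twist_def act_r d_inv r_inv)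
qed

lemma twist_outside: "x \<notin> r ` U \<Longrightarrow> twist U a b x = 0"
  by (simp add: twist_def act_outside)

text \<open>Continuity comes from membership in \<open>D U\<close>. If \<open>r u\<close> is outside
  the range of the product, then \<open>d u\<close> is outside that of \<open>V\<close>, which kills
  the factor \<open>b (d u)\<close>.\<close>

lemma twist_D:
  assumes U: "U \<in> cob" and V: "V \<in> cob" and a: "a \<in> D U" and b: "b \<in> D V"
  shows "twist U a b \<in> D (U \<odot> V)"
proof -
  have "act (iv ` U) a \<in> D (iv ` U)" using U a by (intro act_closed cob_inv D_carrier)
  then have "(\<lambda>x. act (iv ` U) a x * b x) \<in> carrier A"
    using D_mult[OF cob_inv[OF U]] b D_carrier by blast
  then have "twist U a b \<in> D U" unfolding twist_def by (rule act_closed[OF U])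
  then have "continuous_map (unit_top G) euclidean (twist U a b)" using carrier_A_continuous D_carrier by blast
  moreover have "twist U a b x = 0" if x: "x \<notin> r ` (U \<odot> V)" for x
  proof (cases "x \<in> r ` U")
    case True
    then obtain u where u: "u \<in> U" "x = r u" by auto
    have "d u \<notin> r ` V"
    proof
      assume "d u \<in> r ` V"
      then obtain v where v: "v \<in> V" "d u = r v" by auto
      then have "r (u \<cdot> v) = r u" using u cob_arrows[OF U] cob_arrows[OF V] r_mult[of u v] by blast
      then show False using x u setmultI[OF u(1) v] by (metis imageI)
    qed
    then have "b (d u) = 0" using D_outside[OF V b] by blast
    then show ?thesis using u U by (simp add: twist_r)
  qed (simp add: twist_outside)
  ultimately show ?thesis using D_iff[OF cob_setmult[OF U V]] by blast
qed

lemma L_mult_eq: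
  assumes \<phi>: "\<phi> \<in> carrier L" and \<psi>: "\<psi> \<in> carrier L"
  shows "(\<phi> \<otimes>\<^bsub>L\<^esub> \<psi>) W =
    (\<lambda>x. \<Sum>p\<in>{p \<in> supp \<phi> \<times> supp \<psi>. fst p \<odot> snd p = W}. twist (fst p) (\<phi> (fst p)) (\<psi> (snd p)) x)"
proof -
  let ?I = "{p \<in> supp \<phi> \<times> supp \<psi>. fst p \<odot> snd p = W}"
  let ?f = "\<lambda>p. twist (fst p) (\<phi> (fst p)) (\<psi> (snd p))"
  have cob: "U \<in> cob" "V \<in> cob" if "(U, V) \<in> supp \<phi> \<times> supp \<psi>" for U V
    using \<phi> \<psi> that by (auto simp: carrier_L)
  have I: "{(U, V). U \<in> carrier B \<and> V \<in> carrier B \<and> U \<otimes>\<^bsub>B\<^esub> V = W \<and> \<phi> U \<noteq> \<zero>\<^bsub>A\<^esub> \<and> \<psi> V \<noteq> \<zero>\<^bsub>A\<^esub>} = ?I"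
    using cob by auto
  have "(\<phi> \<otimes>\<^bsub>L\<^esub> \<psi>) W = finsum A (\<lambda>p. case p of (U, V) \<Rightarrow> act U (\<lambda>x. act (iv ` U) (\<phi> U) x * \<psi> V x)) ?I"
    unfolding skew_sum_def I[symmetric] by simp
  also have "\<dots> = finsum A ?f ?I"
    by (rule arg_cong[of _ _ "\<lambda>f. finsum A f ?I"]) (auto simp: twist_def)
  also have "\<dots> = (\<lambda>x. \<Sum>p\<in>?I. ?f p x)"
  proof (rule finsum_A)
    show "finite ?I" using \<phi> \<psi> by (auto simp: carrier_L)
    fix p assume "p \<in> ?I"
    then obtain U V where p: "p = (U, V)" "(U, V) \<in> supp \<phi> \<times> supp \<psi>" by (cases p) auto
    then have "?f p \<in> D (U \<odot> V)" using cob[OF p(2)] \<phi> \<psi> by (auto intro!: twist_D simp: carrier_L)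
    then show "?f p \<in> carrier A" by (rule D_carrier)
  qed
  finally show ?thesis .
qed

lemma D_sum:
  assumes "U \<in> cob" "\<And>i. i \<in> I \<Longrightarrow> f i \<in> D U"
  shows "(\<lambda>x. \<Sum>i\<in>I. f i x) \<in> D U"
  using assms(2)
proof (induction I rule: infinite_finite_induct)
  case (insert i I)
  then show ?case using D_add[OF assms(1), of "f i"] by simp
qed (simp_all add: D_zero assms)

text \<open>The second claim provides the finite index set over which \<open>skew_hom_mult\<close>
  regroups its terms.\<close>

lemma L_mult:
  assumes \<phi>: "\<phi> \<in> carrier L" and \<psi>: "\<psi> \<in> carrier L"
  shows "\<phi> \<otimes>\<^bsub>L\<^esub> \<psi> \<in> carrier L" "supp (\<phi> \<otimes>\<^bsub>L\<^esub> \<psi>) \<subseteq> (\<lambda>p. fst p \<odot> snd p) ` (supp \<phi> \<times> supp \<psi>)"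
proof -
  note eq = L_mult_eq[OF \<phi> \<psi>]
  let ?M = "(\<lambda>p. fst p \<odot> snd p) ` (supp \<phi> \<times> supp \<psi>)"
  have cob: "U \<in> cob" "V \<in> cob" if "U \<in> supp \<phi>" "V \<in> supp \<psi>" for U V
    using \<phi> \<psi> that by (auto simp: carrier_L)
  have zero: "(\<phi> \<otimes>\<^bsub>L\<^esub> \<psi>) W = (\<lambda>x. 0)" if "W \<notin> ?M" for W
  proof -
    have "{p \<in> supp \<phi> \<times> supp \<psi>. fst p \<odot> snd p = W} = {}" using that by blast
    then show ?thesis unfolding eq by (simp only: sum.empty)
  qed
  then show sub: "supp (\<phi> \<otimes>\<^bsub>L\<^esub> \<psi>) \<subseteq> ?M" by blast
  have M: "?M \<subseteq> cob" using cob by (auto intro!: cob_setmult)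
  have "finite ?M" using \<phi> \<psi> by (auto simp: carrier_L)
  then have "finite (supp (\<phi> \<otimes>\<^bsub>L\<^esub> \<psi>))" using sub finite_subset by blast
  moreover have "(\<phi> \<otimes>\<^bsub>L\<^esub> \<psi>) W \<in> D W" if "W \<in> cob" for W
    unfolding eq
  proof (rule D_sum[OF that])
    fix p assume "p \<in> {p \<in> supp \<phi> \<times> supp \<psi>. fst p \<odot> snd p = W}"
    then have p: "fst p \<in> supp \<phi>" "snd p \<in> supp \<psi>" "fst p \<odot> snd p = W" by auto
    have "\<phi> (fst p) \<in> D (fst p)" "\<psi> (snd p) \<in> D (snd p)"
      using cob[OF p(1,2)] \<phi> \<psi> by (simp_all add: carrier_L)
    then show "twist (fst p) (\<phi> (fst p)) (\<psi> (snd p)) \<in> D W"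
      using twist_D[OF cob[OF p(1,2)]] p(3) by simp
  qed
  moreover have "(\<phi> \<otimes>\<^bsub>L\<^esub> \<psi>) W = (\<lambda>x. 0)" if "W \<notin> cob" for W
    using that M zero by blast
  ultimately show "\<phi> \<otimes>\<^bsub>L\<^esub> \<psi> \<in> carrier L" unfolding carrier_L by blast
qed

subsection \<open>The homomorphism onto the groupoid algebra\<close>

definition skew_hom where
  "skew_hom \<phi> x = (\<Sum>U\<in>supp \<phi>. if x \<in> U then \<phi> U (r x) else 0)"

lemma skew_hom_eq:
  assumes "finite F" "supp \<phi> \<subseteq> F"
  shows "skew_hom \<phi> x = (\<Sum>U\<in>F. if x \<in> U then \<phi> U (r x) else 0)"
  unfolding skew_hom_def using assms by (intro sum.mono_neutral_left) auto

lemma skew_hom_add: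
  assumes "\<phi> \<in> carrier L" "\<psi> \<in> carrier L"
  shows "skew_hom (\<lambda>U x. \<phi> U x + \<psi> U x) = (\<lambda>x. skew_hom \<phi> x + skew_hom \<psi> x)"
proof
  fix x
  let ?F = "supp \<phi> \<union> supp \<psi>"
  have F: "finite ?F" using assms by (simp add: carrier_L)
  have "supp (\<lambda>U x. \<phi> U x + \<psi> U x) \<subseteq> ?F" by auto
  then show "skew_hom (\<lambda>U x. \<phi> U x + \<psi> U x) x = skew_hom \<phi> x + skew_hom \<psi> x"
    using skew_hom_eq[OF F, of \<phi>] skew_hom_eq[OF F, of \<psi>] skew_hom_eq[OF F, of "\<lambda>U x. \<phi> U x + \<psi> U x"]
    by (simp add: sum.distrib[symmetric] if_distrib cong: if_cong)
qed

lemma skew_hom_delta: "skew_hom (dl a U) = (\<lambda>x. if x \<in> U then a (r x) else 0)"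
proof
  fix x
  have "skew_hom (dl a U) x = (\<Sum>V\<in>{U}. if x \<in> V then dl a U V (r x) else 0)"
    by (rule skew_hom_eq) (auto simp: delta_apply)
  then show "skew_hom (dl a U) x = (if x \<in> U then a (r x) else 0)" by (simp add: delta_apply)
qed

lemma skew_hom_minus: "skew_hom (\<lambda>U x. - \<phi> U x) = (\<lambda>x. - skew_hom \<phi> x)"
proof
  fix x
  have "supp (\<lambda>U x. - \<phi> U x) = supp \<phi>" by (auto simp: fun_eq_iff)
  then show "skew_hom (\<lambda>U x. - \<phi> U x) x = - skew_hom \<phi> x"
    unfolding skew_hom_def by (simp add: sum_negf[symmetric]) (intro sum.cong, auto)
qed

text \<open>Each of the finitely many bisections in the support meets a range fibre in at most one
  arrow.\<close>

lemma row_finite_skew_hom: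
  assumes \<phi>: "\<phi> \<in> carrier L"
  shows "row_finite (skew_hom \<phi>)"
proof -
  have cob: "U \<in> cob" if "U \<in> supp \<phi>" for U using \<phi> that by (auto simp: carrier_L)
  have nz: "\<exists>U\<in>supp \<phi>. x \<in> U" if "skew_hom \<phi> x \<noteq> 0" for x
  proof (rule ccontr)
    assume "\<not> ?thesis"
    then have "skew_hom \<phi> x = 0" unfolding skew_hom_def by (intro sum.neutral) auto
    then show False using that by simp
  qed
  have "finite {x \<in> arrows G. r x = y \<and> skew_hom \<phi> x \<noteq> 0}" for y
  proof (rule finite_subset)
    show "{x \<in> arrows G. r x = y \<and> skew_hom \<phi> x \<noteq> 0} \<subseteq> (\<lambda>U. sec U y) ` supp \<phi>"
    proof
      fix x assume x: "x \<in> {x \<in> arrows G. r x = y \<and> skew_hom \<phi> x \<noteq> 0}"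
      then obtain U where U: "U \<in> supp \<phi>" "x \<in> U" using nz by blast
      then have "x = sec U y" using x sec_r[OF cob[OF U(1)] U(2)] by simp
      then show "x \<in> (\<lambda>U. sec U y) ` supp \<phi>" using U by blast
    qed
    show "finite ((\<lambda>U. sec U y) ` supp \<phi>)" using \<phi> by (simp add: carrier_L)
  qed
  moreover have "skew_hom \<phi> x = 0" if "x \<notin> arrows G" for x using nz[of x] cob cob_arrows that by blast
  ultimately show ?thesis by (simp add: row_finite_def)
qed

text \<open>Multiplicativity on single terms: only the arrow \<open>u\<close> of \<open>U\<close>
  with range \<open>r x\<close> contributes. \<open>twist_r\<close> gives its value, and
  \<open>setmult_iff\<close> says when it is present.\<close>

lemma twist_sum:
  assumes U: "U \<in> cob" and V: "V \<in> cob" and x: "x \<in> arrows G"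
    and P: "finite P" "P \<subseteq> {b \<in> arrows G. r b = r x}" "{b \<in> U. r b = r x} \<subseteq> P"
  shows "(\<Sum>b\<in>P. (if b \<in> U then a (r b) else 0) * (if iv b \<cdot> x \<in> V then c (r (iv b \<cdot> x)) else 0))
    = (if x \<in> U \<odot> V then twist U a c (r x) else 0)"
proof (cases "r x \<in> r ` U")
  case True
  then obtain u where u: "u \<in> U" "r u = r x" by auto
  have ua: "u \<in> arrows G" using u cob_arrows[OF U] by auto
  have iff: "x \<in> U \<odot> V \<longleftrightarrow> iv u \<cdot> x \<in> V" using u x by (intro setmult_iff cob_bisection U cob_arrows V)
  have "r (iv u \<cdot> x) = d u" using u ua x by (simp add: r_mult inv_closed d_inv r_inv)
  have tw: "twist U a c (r x) = a (r u) * c (d u)" using twist_r[OF U u(1)] u(2) by metis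
  have "b = u" if "b \<in> P" "b \<in> U" for b
    using that P(2) u bisection_r_eq[OF cob_bisection[OF U], of b u] by auto
  then have "(\<Sum>b\<in>P. (if b \<in> U then a (r b) else 0) * (if iv b \<cdot> x \<in> V then c (r (iv b \<cdot> x)) else 0))
    = (\<Sum>b\<in>{u}. (if b \<in> U then a (r b) else 0) * (if iv b \<cdot> x \<in> V then c (r (iv b \<cdot> x)) else 0))"
    using P u by (intro sum.mono_neutral_right) auto
  also have "\<dots> = (if x \<in> U \<odot> V then twist U a c (r x) else 0)"
    using u(1) iff tw \<open>r (iv u \<cdot> x) = d u\<close> by simp
  finally show ?thesis .
next
  case False
  then have "x \<notin> U \<odot> V" using setmultD[of x U V] cob_arrows[OF U] cob_arrows[OF V] by auto
  moreover have "b \<notin> U" if "b \<in> P" for b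
  proof
    assume "b \<in> U"
    moreover have "r b = r x" using that P(2) by blast
    ultimately show False using False by (metis imageI)
  qed
  ultimately show ?thesis by (simp add: sum.neutral)
qed

text \<open>The convolution is expanded over pairs of bisections and each pair is evaluated by
  \<open>twist_sum\<close>.\<close>

lemma skew_hom_mult:
  assumes \<phi>: "\<phi> \<in> carrier L" and \<psi>: "\<psi> \<in> carrier L"
  shows "skew_hom (\<phi> \<otimes>\<^bsub>L\<^esub> \<psi>) = conv (skew_hom \<phi>) (skew_hom \<psi>)"
proof
  fix x show "skew_hom (\<phi> \<otimes>\<^bsub>L\<^esub> \<psi>) x = conv (skew_hom \<phi>) (skew_hom \<psi>) x"
  proof (cases "x \<in> arrows G")
    case x: True
    let ?F = "supp \<phi>" and ?F' = "supp \<psi>"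
    \<comment> \<open>The arrows over \<open>r x\<close> in the bisections of the support of
      \<open>\<phi>\<close>: one finite index set that serves all pairs.\<close>
    let ?P = "(\<lambda>U. sec U (r x)) ` {U \<in> ?F. r x \<in> r ` U}"
    let ?t = "\<lambda>p. twist (fst p) (\<phi> (fst p)) (\<psi> (snd p)) (r x)"
    let ?m = "\<lambda>p. fst p \<odot> snd p"
    have fin: "finite ?F" "finite ?F'" using \<phi> \<psi> by (auto simp: carrier_L)
    have cobF: "U \<in> cob" if "U \<in> ?F" for U using \<phi> that by (auto simp: carrier_L)
    have cobF': "U \<in> cob" if "U \<in> ?F'" for U using \<psi> that by (auto simp: carrier_L)
    have P1: "?P \<subseteq> {b \<in> arrows G. r b = r x}"
    proof
      fix b assume "b \<in> ?P"
      then obtain U where U: "U \<in> ?F" "r x \<in> r ` U" "b = sec U (r x)" by blast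
      then have "b \<in> U" "r b = r x" using sec_in r_sec by metis+
      then show "b \<in> {b \<in> arrows G. r b = r x}" using cob_arrows[OF cobF[OF U(1)]] by blast
    qed
    have P2: "{b \<in> U. r b = r x} \<subseteq> ?P" if U: "U \<in> ?F" for U
    proof
      fix b assume b: "b \<in> {b \<in> U. r b = r x}"
      then have "b = sec U (r x)" "r x \<in> r ` U" using sec_r[OF cobF[OF U], of b] by (simp, metis (mono_tags, lifting) imageI mem_Collect_eq)
      then show "b \<in> ?P" using U by blast
    qed
    have P3: "{b \<in> arrows G. r b = r x \<and> skew_hom \<phi> b \<noteq> 0} \<subseteq> ?P"
    proof
      fix b assume b: "b \<in> {b \<in> arrows G. r b = r x \<and> skew_hom \<phi> b \<noteq> 0}"
      then obtain U where "U \<in> ?F" "(if b \<in> U then \<phi> U (r b) else 0) \<noteq> 0"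
        unfolding skew_hom_def by (auto elim: sum.not_neutral_contains_not_neutral)
      then have "U \<in> ?F" "b \<in> U" by (auto split: if_splits)
      then show "b \<in> ?P" using P2 b by blast
    qed
    have "conv (skew_hom \<phi>) (skew_hom \<psi>) x = (\<Sum>b\<in>?P. skew_hom \<phi> b * skew_hom \<psi> (iv b \<cdot> x))"
      using fin by (intro row_finite_conv_eq row_finite_skew_hom \<phi> \<psi> x P1 P3) simp
    also have "\<dots> = (\<Sum>b\<in>?P. \<Sum>p\<in>?F \<times> ?F'. (if b \<in> fst p then \<phi> (fst p) (r b) else 0)
        * (if iv b \<cdot> x \<in> snd p then \<psi> (snd p) (r (iv b \<cdot> x)) else 0))"
      unfolding skew_hom_def sum_product sum.cartesian_product by (simp only: case_prod_unfold)
    also have "\<dots> = (\<Sum>p\<in>?F \<times> ?F'. \<Sum>b\<in>?P. (if b \<in> fst p then \<phi> (fst p) (r b) else 0)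
        * (if iv b \<cdot> x \<in> snd p then \<psi> (snd p) (r (iv b \<cdot> x)) else 0))"
      by (rule sum.swap)
    also have "\<dots> = (\<Sum>p\<in>?F \<times> ?F'. if x \<in> ?m p then ?t p else 0)"
    proof (rule sum.cong[OF refl])
      fix p assume "p \<in> ?F \<times> ?F'"
      then have p: "fst p \<in> ?F" "snd p \<in> ?F'" by auto
      show "(\<Sum>b\<in>?P. (if b \<in> fst p then \<phi> (fst p) (r b) else 0)
        * (if iv b \<cdot> x \<in> snd p then \<psi> (snd p) (r (iv b \<cdot> x)) else 0)) = (if x \<in> ?m p then ?t p else 0)"
        using fin by (intro twist_sum cobF[OF p(1)] cobF'[OF p(2)] x P1 P2[OF p(1)]) simp
    qed
    \<comment> \<open>Different pairs may have the same product \<open>W\<close>; grouping collects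
      their twists into the coefficient at \<open>W\<close>.\<close>
    also have "\<dots> = (\<Sum>W\<in>?m ` (?F \<times> ?F'). \<Sum>p\<in>{p \<in> ?F \<times> ?F'. ?m p = W}. if x \<in> ?m p then ?t p else 0)"
      using fin by (intro sum.group[symmetric]) auto
    also have "\<dots> = (\<Sum>W\<in>?m ` (?F \<times> ?F'). if x \<in> W then (\<phi> \<otimes>\<^bsub>L\<^esub> \<psi>) W (r x) else 0)"
    proof (rule sum.cong[OF refl])
      fix W
      have "(\<Sum>p\<in>{p \<in> ?F \<times> ?F'. ?m p = W}. if x \<in> ?m p then ?t p else 0)
        = (\<Sum>p\<in>{p \<in> ?F \<times> ?F'. ?m p = W}. if x \<in> W then ?t p else 0)"
        by (rule sum.cong[OF refl]) auto
      then show "(\<Sum>p\<in>{p \<in> ?F \<times> ?F'. ?m p = W}. if x \<in> ?m p then ?t p else 0)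
        = (if x \<in> W then (\<phi> \<otimes>\<^bsub>L\<^esub> \<psi>) W (r x) else 0)"
        unfolding L_mult_eq[OF \<phi> \<psi>] by (cases "x \<in> W") simp_all
    qed
    also have "\<dots> = skew_hom (\<phi> \<otimes>\<^bsub>L\<^esub> \<psi>) x"
      using fin L_mult(2)[OF \<phi> \<psi>] by (intro skew_hom_eq[symmetric]) auto
    finally show ?thesis by simp
  next
    case False
    then show ?thesis
      using row_finite_skew_hom[OF L_mult(1)[OF \<phi> \<psi>]] by (simp add: conv_outside row_finite_def)
  qed
qed

subsection \<open>The image of the homomorphism\<close>

lemma continuous_map_r_unit_top: "continuous_map X (unit_top G) r"
  unfolding unit_top_def using continuous_map_r r_units by (auto intro!: continuous_map_into_subtopology)

abbreviation gens where
  "gens \<equiv> {f :: _ \<Rightarrow> complex. \<exists>U\<in>cob. (\<forall>x. x \<notin> U \<longrightarrow> f x = 0) \<and>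
    continuous_map (subtopology X U) euclidean f}"

text \<open>A generator \<open>f\<close> on \<open>U\<close> is recovered from its transfer along
  \<open>sec U\<close> to the clopen range, extended by zero.\<close>

lemma gens_eq: "gens = {skew_hom (dl a U) | a U. U \<in> cob \<and> a \<in> D U}"
proof (intro equalityI subsetI)
  fix f assume "f \<in> gens"
  then obtain U where U: "U \<in> cob" and f: "\<And>x. x \<notin> U \<Longrightarrow> f x = 0" "continuous_map (subtopology X U) euclidean f"
    by auto
  note rU = cob_r_image[OF U]
  define a where "a x = (if x \<in> r ` U then f (sec U x) else 0)" for x
  have eq: "subtopology (unit_top G) (r ` U) = subtopology X (r ` U)"
    using rU by (simp add: unit_top_def subtopology_subtopology inf.absorb2)
  have "continuous_map (subtopology X (r ` U)) (subtopology X U) (sec U)"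
    by (rule continuous_map_into_subtopology[OF continuous_map_sec[OF U]]) (auto intro: sec_in)
  from continuous_map_compose[OF this f(2)]
  have "continuous_map (subtopology X (r ` U)) euclidean a"
    by (rule continuous_map_eq) (auto simp: a_def)
  then have "continuous_map (unit_top G) euclidean a"
    using rU by (rule_tac continuous_map_extend_zero[of _ "r ` U"]) (auto simp: eq a_def)
  then have "a \<in> D U" by (simp add: D_iff[OF U] a_def)
  moreover have "f = skew_hom (dl a U)" using f(1) by (auto simp: skew_hom_delta a_def sec_r[OF U])
  ultimately show "f \<in> {skew_hom (dl a U) | a U. U \<in> cob \<and> a \<in> D U}" using U by blast
next
  fix f assume "f \<in> {skew_hom (dl a U) | a U. U \<in> cob \<and> a \<in> D U}"
  then obtain a U where U: "U \<in> cob" and a: "a \<in> D U" and f: "f = skew_hom (dl a U)" by auto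
  have "continuous_map X euclidean (a \<circ> r)"
    using continuous_map_compose[OF continuous_map_r_unit_top] carrier_A_continuous D_carrier a by blast
  then have "continuous_map (subtopology X U) euclidean (a \<circ> r)" by (rule continuous_map_from_subtopology)
  then have "continuous_map (subtopology X U) euclidean f"
    by (rule continuous_map_eq) (auto simp: f skew_hom_delta)
  then show "f \<in> gens" using U by (auto simp: f skew_hom_delta)
qed

lemma sum_apply: "(\<Sum>i\<in>I. f i) x = (\<Sum>i\<in>I. f i x :: complex)"
  by (induction I rule: infinite_finite_induct) auto

lemma complex_functions_module: "module (\<lambda>(c :: complex) (f :: 'x \<Rightarrow> complex) x. c * f x)"
  by unfold_locales (auto simp: fun_eq_iff algebra_simps)

lemma groupoid_functions_eq: "groupoid_functions G = skew_hom ` carrier L"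
proof -
  interpret M: module "\<lambda>(c :: complex) (f :: _ \<Rightarrow> complex) x. c * f x"
    by (rule complex_functions_module)
  have GF: "groupoid_functions G = M.span gens" by (simp add: groupoid_functions_def)
  have zero: "(0 :: _ \<Rightarrow> complex) = skew_hom (\<lambda>U x. 0)" by (auto simp: skew_hom_def)
  have "M.subspace (skew_hom ` carrier L)"
    unfolding M.subspace_def
  proof (intro conjI ballI allI)
    have "(\<lambda>U x. 0) \<in> carrier L" by (simp add: carrier_L D_zero)
    then show "0 \<in> skew_hom ` carrier L" unfolding zero by blast
  next
    fix f g assume "f \<in> skew_hom ` carrier L" "g \<in> skew_hom ` carrier L"
    then obtain \<phi> \<psi> where "\<phi> \<in> carrier L" "\<psi> \<in> carrier L" "f = skew_hom \<phi>" "g = skew_hom \<psi>" by blast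
    then have "f + g = skew_hom (\<lambda>U x. \<phi> U x + \<psi> U x)" "(\<lambda>U x. \<phi> U x + \<psi> U x) \<in> carrier L"
      using L_add by (auto simp: skew_hom_add)
    then show "f + g \<in> skew_hom ` carrier L" by blast
  next
    fix c f assume "f \<in> skew_hom ` carrier L"
    then obtain \<phi> where \<phi>: "\<phi> \<in> carrier L" "f = skew_hom \<phi>" by blast
    have fin: "finite (supp \<phi>)" using \<phi> by (simp add: carrier_L)
    have sub: "supp (\<lambda>U x. c * \<phi> U x) \<subseteq> supp \<phi>" by auto
    have "(\<lambda>U x. c * \<phi> U x) \<in> carrier L"
      using \<phi>(1) finite_subset[OF sub fin]
      by (simp add: carrier_L D_iff continuous_map_mult_algebra)
    moreover have "(\<lambda>x. c * f x) = skew_hom (\<lambda>U x. c * \<phi> U x)"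
      using skew_hom_eq[OF fin sub] skew_hom_eq[OF fin order.refl]
      by (auto simp: \<phi>(2) fun_eq_iff sum_distrib_left intro!: sum.cong)
    ultimately show "(\<lambda>x. c * f x) \<in> skew_hom ` carrier L" by blast
  qed
  moreover have "gens \<subseteq> skew_hom ` carrier L" unfolding gens_eq using L_delta by blast
  ultimately have "M.span gens \<subseteq> skew_hom ` carrier L" by (intro M.span_minimal)
  moreover have "skew_hom \<phi> \<in> M.span gens" if \<phi>: "\<phi> \<in> carrier L" for \<phi>
  proof -
    have eq: "skew_hom \<phi> = (\<Sum>U\<in>supp \<phi>. skew_hom (dl (\<phi> U) U))"
      by (auto simp: fun_eq_iff skew_hom_delta skew_hom_def[of \<phi>] sum_apply)
    have *: "skew_hom (dl (\<phi> U) U) \<in> M.span gens" if "U \<in> supp \<phi>" for U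
    proof (rule M.span_base)
      have "U \<in> cob" "\<phi> U \<in> D U" using \<phi> that by (auto simp: carrier_L)
      then show "skew_hom (dl (\<phi> U) U) \<in> gens" unfolding gens_eq by blast
    qed
    show ?thesis unfolding eq by (rule M.span_sum[OF *])
  qed
  ultimately show ?thesis unfolding GF by blast
qed

text \<open>Closure is inherited from \<open>L\<close> through \<open>skew_hom\<close>;
  associativity and distributivity come from row-finiteness.\<close>

lemma nonunital_ring_C: "nonunital_ring C"
proof -
  have rf: "row_finite f" if "f \<in> groupoid_functions G" for f
    using that row_finite_skew_hom by (auto simp: groupoid_functions_eq)
  have add: "(\<lambda>x. f x + g x) \<in> groupoid_functions G"
    if fg: "f \<in> groupoid_functions G" "g \<in> groupoid_functions G" for f g
  proof -
    obtain \<phi> \<psi> where *: "\<phi> \<in> carrier L" "\<psi> \<in> carrier L" "f = skew_hom \<phi>" "g = skew_hom \<psi>"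
      using fg unfolding groupoid_functions_eq by blast
    show ?thesis unfolding groupoid_functions_eq *(3,4)
      by (rule image_eqI[where f = skew_hom, OF skew_hom_add[OF *(1,2), symmetric] L_add[OF *(1,2)]])
  qed
  have mult: "conv f g \<in> groupoid_functions G"
    if fg: "f \<in> groupoid_functions G" "g \<in> groupoid_functions G" for f g
  proof -
    obtain \<phi> \<psi> where *: "\<phi> \<in> carrier L" "\<psi> \<in> carrier L" "f = skew_hom \<phi>" "g = skew_hom \<psi>"
      using fg unfolding groupoid_functions_eq by blast
    show ?thesis unfolding groupoid_functions_eq *(3,4)
      by (rule image_eqI[where f = skew_hom, OF skew_hom_mult[OF *(1,2), symmetric] L_mult(1)[OF *(1,2)]])
  qed
  have minus: "(\<lambda>x. - f x) \<in> groupoid_functions G" if f: "f \<in> groupoid_functions G" for f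
  proof -
    obtain \<phi> where *: "\<phi> \<in> carrier L" "f = skew_hom \<phi>" using f unfolding groupoid_functions_eq by blast
    show ?thesis unfolding groupoid_functions_eq *(2)
      by (rule image_eqI[where f = skew_hom, OF skew_hom_minus[symmetric] L_minus[OF *(1)]])
  qed
  have zero: "(\<lambda>x. 0) \<in> groupoid_functions G"
  proof -
    have "(\<lambda>U x. 0) \<in> carrier L" by (simp add: carrier_L D_zero)
    moreover have "skew_hom (\<lambda>U x. 0) = (\<lambda>x. 0)" by (auto simp: skew_hom_def)
    ultimately show ?thesis unfolding groupoid_functions_eq by (metis (no_types, lifting) imageI)
  qed
  have "abelian_group C"
  proof (rule abelian_groupI)
    show "\<exists>g\<in>carrier C. g \<oplus>\<^bsub>C\<^esub> f = \<zero>\<^bsub>C\<^esub>" if "f \<in> carrier C" for f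
      using minus[of f] that by (intro bexI[of _ "\<lambda>x. - f x"]) auto
  qed (auto simp: add zero ac_simps)
  then show ?thesis
    by (intro nonunital_ring.intro nonunital_ring_axioms.intro)
      (auto simp: mult rf conv_assoc conv_add_left conv_add_right)
qed

subsection \<open>The kernel of the homomorphism\<close>

abbreviation kernel where "kernel \<equiv> {\<phi> \<in> carrier L. skew_hom \<phi> = (\<lambda>x. 0)}"

abbreviation rels where
  "rels \<equiv> {dl a U \<ominus>\<^bsub>L\<^esub> dl a V | a U V. natural_le B U V \<and> a \<in> D U}"

lemma N_def: "N = ideal_generated L rels"
  by (simp add: skew_relations_def)

lemma D_mono:
  assumes "U \<in> cob" "V \<in> cob" "U \<subseteq> V" "a \<in> D U"
  shows "a \<in> D V"
  using assms(4) image_mono[OF assms(3), of r] unfolding D_iff[OF assms(1)] D_iff[OF assms(2)] by blast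

lemma rels_eq: "rels = {\<lambda>W x. dl a U W x - dl a V W x | a U V. U \<in> cob \<and> V \<in> cob \<and> U \<subseteq> V \<and> a \<in> D U}"
proof -
  have eq: "dl a U \<ominus>\<^bsub>L\<^esub> dl a V = (\<lambda>W x. dl a U W x - dl a V W x)"
    if "U \<in> cob" "V \<in> cob" "U \<subseteq> V" "a \<in> D U" for a U V
    using that L_delta D_mono[of U V a] by (intro a_minus_L) auto
  show ?thesis
    unfolding natural_le_B
  proof (intro Collect_cong iff_exI)
    fix \<phi> a U V
    show "\<phi> = dl a U \<ominus>\<^bsub>L\<^esub> dl a V \<and> (U \<in> cob \<and> V \<in> cob \<and> U \<subseteq> V) \<and> a \<in> D U \<longleftrightarrow>
      \<phi> = (\<lambda>W x. dl a U W x - dl a V W x) \<and> U \<in> cob \<and> V \<in> cob \<and> U \<subseteq> V \<and> a \<in> D U"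
      using eq[of U V a] by auto
  qed
qed

lemma two_sided_ideal_kernel: "two_sided_ideal kernel L"
  unfolding two_sided_ideal_def
proof (intro conjI ballI)
  show "additive_subgroup kernel L"
  proof (rule additive_subgroup_closedI)
    show "\<zero>\<^bsub>L\<^esub> \<in> kernel" by (auto simp: carrier_L D_zero skew_hom_def)
  qed (auto simp: L_add L_minus a_inv_L skew_hom_add skew_hom_minus)
  fix \<phi> \<psi> assume \<phi>: "\<phi> \<in> kernel" and \<psi>: "\<psi> \<in> carrier L"
  then have c: "\<phi> \<in> carrier L" "skew_hom \<phi> = (\<lambda>x. 0)" by auto
  have "conv (skew_hom \<phi>) (skew_hom \<psi>) = (\<lambda>x. 0)" "conv (skew_hom \<psi>) (skew_hom \<phi>) = (\<lambda>x. 0)"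
    unfolding c(2) by (auto simp: convolution_def)
  then show "\<psi> \<otimes>\<^bsub>L\<^esub> \<phi> \<in> kernel" "\<phi> \<otimes>\<^bsub>L\<^esub> \<psi> \<in> kernel"
    using c \<psi> by (simp_all add: L_mult(1) skew_hom_mult)
qed

lemma N_subset_kernel: "N \<subseteq> kernel"
  unfolding N_def
proof (rule ideal_generated_mono[OF two_sided_ideal_kernel])
  show "rels \<subseteq> kernel"
  proof
    fix \<phi> assume "\<phi> \<in> rels"
    then obtain a U V where *: "U \<in> cob" "V \<in> cob" "U \<subseteq> V" "a \<in> D U"
      and \<phi>: "\<phi> = (\<lambda>W x. dl a U W x + - dl a V W x)"
      unfolding rels_eq by auto
    have c: "dl a U \<in> carrier L" "dl a V \<in> carrier L" using * L_delta D_mono by blast+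
    \<comment> \<open>By injectivity of \<open>r\<close> on the larger \<open>V\<close>, an arrow
      outside \<open>U\<close> has range outside that of \<open>U\<close>. So both deltas have the
      same image.\<close>
    have "a (r x) = 0" if "x \<in> V" "x \<notin> U" for x
    proof (rule D_outside[OF *(1,4)])
      show "r x \<notin> r ` U" using that * bisection_r_eq[OF cob_bisection[OF *(2)]] by blast
    qed
    then have "skew_hom (dl a U) = skew_hom (dl a V)" using *(3)
      unfolding skew_hom_delta by (intro ext) auto
    moreover have "skew_hom \<phi> = (\<lambda>x. skew_hom (dl a U) x + - skew_hom (dl a V) x)"
      unfolding \<phi> using skew_hom_add[OF c(1) L_minus[OF c(2)]] skew_hom_minus[of "dl a V"] by simp
    moreover have "\<phi> \<in> carrier L" unfolding \<phi> by (rule L_add[OF c(1) L_minus[OF c(2)]])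
    ultimately show "\<phi> \<in> kernel" by simp
  qed
qed

text \<open>Each closure property passes from the individual ideals to their intersection
  \<open>N\<close>. With \<open>N_rel\<close>, these additive facts are what the inclusion of
  \<open>kernel\<close> in \<open>N\<close> draws on.\<close>

lemma
  shows N_zero: "(\<lambda>U x. 0) \<in> N"
    and N_add: "\<phi> \<in> N \<Longrightarrow> \<psi> \<in> N \<Longrightarrow> (\<lambda>U x. \<phi> U x + \<psi> U x) \<in> N"
    and N_diff: "\<phi> \<in> N \<Longrightarrow> \<psi> \<in> N \<Longrightarrow> (\<lambda>U x. \<phi> U x - \<psi> U x) \<in> N"
    and N_rel: "U \<in> cob \<Longrightarrow> V \<in> cob \<Longrightarrow> U \<subseteq> V \<Longrightarrow> a \<in> D U \<Longrightarrow> (\<lambda>W x. dl a U W x - dl a V W x) \<in> N"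
proof -
  have N: "\<phi> \<in> N \<longleftrightarrow> (\<forall>I. two_sided_ideal I L \<and> rels \<subseteq> I \<longrightarrow> \<phi> \<in> I)" for \<phi>
    unfolding N_def ideal_generated_def by blast
  have sub: "additive_subgroup I L" if "two_sided_ideal I L" for I
    using that by (simp add: two_sided_ideal_def)
  have zero: "(\<lambda>U x. 0) \<in> I" if "two_sided_ideal I L" for I
    using additive_subgroup.zero_closed[OF sub[OF that]] by simp
  have add: "(\<lambda>U x. \<phi> U x + \<psi> U x) \<in> I" if "two_sided_ideal I L" "\<phi> \<in> I" "\<psi> \<in> I" for I \<phi> \<psi>
    using additive_subgroup.a_closed[OF sub[OF that(1)] that(2,3)] by simp
  have minus: "(\<lambda>U x. - \<phi> U x) \<in> I" if I: "two_sided_ideal I L" "\<phi> \<in> I" for I \<phi>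
  proof -
    have "a_inv L \<phi> \<in> I"
      using subgroup.m_inv_closed[OF additive_subgroup.a_subgroup[OF sub[OF I(1)]]] I(2) by (simp add: a_inv_def)
    moreover have "\<phi> \<in> carrier L" using additive_subgroup.a_subset[OF sub[OF I(1)]] I(2) by blast
    ultimately show ?thesis by (simp add: a_inv_L)
  qed
  show "(\<lambda>U x. 0) \<in> N" unfolding N using zero by blast
  show add_N: "(\<lambda>U x. \<phi> U x + \<psi> U x) \<in> N" if "\<phi> \<in> N" "\<psi> \<in> N" for \<phi> \<psi>
    using that add unfolding N by blast
  show "(\<lambda>U x. \<phi> U x - \<psi> U x) \<in> N" if "\<phi> \<in> N" "\<psi> \<in> N" for \<phi> \<psi>
  proof -
    have "(\<lambda>U x. - \<psi> U x) \<in> N" using that(2) minus unfolding N by blast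
    from add_N[OF that(1) this] show ?thesis by simp
  qed
  show "(\<lambda>W x. dl a U W x - dl a V W x) \<in> N"
    if "U \<in> cob" "V \<in> cob" "U \<subseteq> V" "a \<in> D U" for a U V
    unfolding N using that unfolding rels_eq by blast
qed

text \<open>If \<open>a \<circ> r\<close> vanishes on the part of \<open>U\<close> not covered by the finite family \<open>F\<close>, then
  \<open>a \<delta>\<^sub>U\<close> can be redistributed over \<open>F\<close>: modulo \<open>N\<close> one has
  \<open>b \<delta>\<^sub>U = b \<delta>\<^bsub>U \<inter> V\<^esub> = b \<delta>\<^sub>V\<close> for \<open>b = a \<cdot> chi (U \<inter> V)\<close>.\<close>

lemma redistribute:
  assumes "finite F" "F \<subseteq> cob" "U \<in> cob" "a \<in> D U"
    and "\<And>x. x \<in> U \<Longrightarrow> x \<notin> \<Union>F \<Longrightarrow> a (r x) = 0"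
  shows "\<exists>\<psi>\<in>carrier L. supp \<psi> \<subseteq> F \<and> (\<lambda>W x. dl a U W x - \<psi> W x) \<in> N"
  using assms
proof (induction F arbitrary: a rule: finite_induct)
  case empty
  have "a y = 0" for y
    using empty D_outside[OF empty(2,3), of y] by (cases "y \<in> r ` U") auto
  then have "a = (\<lambda>x. 0)" by auto
  then have "dl a U = (\<lambda>W x. 0)" by (auto simp: delta_apply)
  then show ?case using N_zero by (intro bexI[of _ "\<lambda>W x. 0"]) (auto simp: carrier_L D_zero)
next
  case (insert V F)
  have U: "U \<in> cob" and V: "V \<in> cob" and F: "F \<subseteq> cob" using insert.prems by auto
  have UV: "U \<inter> V \<in> cob" using U V by (rule cob_Int)
  \<comment> \<open>\<open>b\<close> is the piece of \<open>a\<close> that moves to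
    \<open>V\<close>; \<open>c\<close> stays on \<open>U\<close> and is left to the smaller
    family.\<close>
  define b where "b = (\<lambda>x. a x * chi (U \<inter> V) x)"
  define c where "c = (\<lambda>x. a x - b x)"
  have bUV: "b \<in> D (U \<inter> V)" unfolding b_def using insert.prems UV
    by (intro D_mult_right chi_D) (auto dest: D_carrier)
  have bU: "b \<in> D U" and bV: "b \<in> D V" using D_mono[OF UV _ _ bUV] U V by auto
  have cU: "c \<in> D U" using D_add[OF U insert.prems(3) D_minus[OF U bU]] by (simp add: c_def)
  \<comment> \<open>On \<open>U \<inter> V\<close> the cut-off is \<open>1\<close>, so
    \<open>b\<close> takes all of \<open>a\<close>; outside \<open>V\<close> and \<open>F\<close>
    already \<open>a (r x)\<close>, hence also \<open>b (r x)\<close>, vanishes.\<close>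
  have "c (r x) = 0" if x: "x \<in> U" "x \<notin> \<Union>F" for x
  proof (cases "x \<in> V")
    case True
    then have "chi (U \<inter> V) (r x) = 1" using x by (simp add: chi_def)
    then show ?thesis by (simp add: c_def b_def)
  next
    case False
    then show ?thesis using x insert.prems(4)[of x] by (simp add: c_def b_def)
  qed
  then obtain \<psi> where \<psi>: "\<psi> \<in> carrier L" "supp \<psi> \<subseteq> F" "(\<lambda>W x. dl c U W x - \<psi> W x) \<in> N"
    using insert.IH[OF F U cU] by blast
  let ?\<psi> = "\<lambda>W x. \<psi> W x + dl b V W x"
  have c1: "?\<psi> \<in> carrier L" using L_add[OF \<psi>(1) L_delta[OF V bV]] .
  have c2: "supp ?\<psi> \<subseteq> insert V F" using \<psi>(2) by (auto simp: delta_apply)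
  have c3: "(\<lambda>W x. dl a U W x - ?\<psi> W x) \<in> N"
  proof -
    \<comment> \<open>The relations for \<open>U \<inter> V\<close> inside \<open>V\<close> and
      inside \<open>U\<close> differ by \<open>dl b U - dl b V\<close>, the required move.\<close>
    have "(\<lambda>W x. (dl b (U \<inter> V) W x - dl b V W x) - (dl b (U \<inter> V) W x - dl b U W x)) \<in> N"
      using N_diff[OF N_rel[OF UV V _ bUV] N_rel[OF UV U _ bUV]] by simp
    from N_add[OF \<psi>(3) this]
    have "(\<lambda>W x. dl c U W x - \<psi> W x + (dl b (U \<inter> V) W x - dl b V W x - (dl b (U \<inter> V) W x - dl b U W x))) \<in> N" .
    moreover have "dl a U W x = dl c U W x + dl b U W x" for W x by (simp add: delta_apply c_def)
    ultimately show ?thesis by (simp add: algebra_simps)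
  qed
  show ?case by (rule bexI[of _ ?\<psi>], rule conjI[OF c2 c3], rule c1)
qed

lemma kernel_subset_N:
  assumes "finite F" "F \<subseteq> cob" "\<phi> \<in> carrier L" "supp \<phi> \<subseteq> F" "skew_hom \<phi> = (\<lambda>x. 0)"
  shows "\<phi> \<in> N"
  using assms
proof (induction F arbitrary: \<phi> rule: finite_induct)
  case empty
  then have "\<phi> = (\<lambda>U x. 0)" by auto
  then show ?case using N_zero by simp
next
  case (insert U F)
  have U: "U \<in> cob" and F: "F \<subseteq> cob" using insert.prems by auto
  have aU: "\<phi> U \<in> D U" using insert.prems U by (simp add: carrier_L)
  \<comment> \<open>At an arrow of \<open>U\<close> outside the other bisections, \<open>U\<close>
    gives the only term of \<open>skew_hom \<phi> x\<close>, which is zero.\<close>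
  have "\<phi> U (r x) = 0" if x: "x \<in> U" "x \<notin> \<Union>F" for x
  proof -
    have "skew_hom \<phi> x = (\<Sum>V\<in>insert U F. if x \<in> V then \<phi> V (r x) else 0)"
      using insert by (intro skew_hom_eq) auto
    also have "\<dots> = \<phi> U (r x) + (\<Sum>V\<in>F. if x \<in> V then \<phi> V (r x) else 0)"
      using insert.hyps x by simp
    also have "(\<Sum>V\<in>F. if x \<in> V then \<phi> V (r x) else 0) = 0" using x by (intro sum.neutral) auto
    finally show ?thesis using insert.prems by simp
  qed
  then obtain \<psi> where \<psi>: "\<psi> \<in> carrier L" "supp \<psi> \<subseteq> F" "(\<lambda>W x. dl (\<phi> U) U W x - \<psi> W x) \<in> N"
    using redistribute[OF insert.hyps(1) F U aU] by blast
  let ?\<rho> = "\<lambda>W x. dl (\<phi> U) U W x + - \<psi> W x"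
  \<comment> \<open>Subtracting \<open>?\<rho>\<close> replaces the coefficient at \<open>U\<close>
    by terms over \<open>F\<close>. Since \<open>?\<rho>\<close> lies in \<open>N\<close>, hence in
    \<open>kernel\<close>, the image stays zero and the induction hypothesis applies.\<close>
  let ?\<phi>' = "\<lambda>W x. \<phi> W x + - ?\<rho> W x"
  have \<rho>: "?\<rho> \<in> N" using \<psi>(3) by simp
  have "?\<rho> \<in> kernel" by (rule subsetD[OF N_subset_kernel \<rho>])
  then have \<rho>': "?\<rho> \<in> carrier L" "skew_hom ?\<rho> = (\<lambda>x. 0)" by simp_all
  have c: "?\<phi>' \<in> carrier L" by (rule L_add[OF insert.prems(2) L_minus[OF \<rho>'(1)]])
  have h0: "skew_hom ?\<phi>' = (\<lambda>x. 0)"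
    using skew_hom_add[OF insert.prems(2) L_minus[OF \<rho>'(1)]] skew_hom_minus[of ?\<rho>] \<rho>'(2) insert.prems(4) by simp
  have "?\<phi>' W = (\<lambda>x. 0)" if "W \<notin> F" for W
  proof -
    have "\<psi> W = (\<lambda>x. 0)" using that \<psi>(2) by blast
    moreover have "\<phi> W = (\<lambda>x. 0)" if "W \<noteq> U" using that \<open>W \<notin> F\<close> insert.prems(3) by blast
    ultimately show ?thesis by (cases "W = U") (simp_all add: delta_apply)
  qed
  then have "supp ?\<phi>' \<subseteq> F" by blast
  then have "?\<phi>' \<in> N" by (rule insert.IH[OF F c _ h0])
  from N_add[OF this \<rho>] show ?case by simp
qed

lemma N_eq_kernel: "N = kernel"
proof (intro equalityI subsetI)
  show "\<phi> \<in> kernel" if "\<phi> \<in> N" for \<phi> using that N_subset_kernel by blast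
  show "\<phi> \<in> N" if \<phi>: "\<phi> \<in> kernel" for \<phi>
  proof -
    have "finite (supp \<phi>)" "supp \<phi> \<subseteq> cob" using \<phi> by (auto simp: carrier_L)
    then show ?thesis using \<phi> kernel_subset_N[of "supp \<phi>" \<phi>] by blast
  qed
qed

lemma ring_isomorphic_C: "ring_isomorphic C (skew_ring A B D act)"
  unfolding skew_ring_def
  by (rule ring_isomorphic_FactRing_kernel[where h = skew_hom])
    (simp_all add: abelian_group_L nonunital_ring_C L_mult(1) groupoid_functions_eq skew_hom_add skew_hom_mult N_eq_kernel)

end

theorem proposition6p1:
  fixes G :: "'g groupoid_data"
  assumes "ample_groupoid G"
    and "Hausdorff_space (gtop G)"
  shows "spectral_action (bisection_semigroup G) (Cc_units G) (bisection_ideal G) (bisection_action G) \<and>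
     ring_isomorphic (Cc_groupoid G)
       (skew_ring (Cc_units G) (bisection_semigroup G) (bisection_ideal G) (bisection_action G))"
proof -
  interpret hausdorff_ample_groupoid G
    using assms by (intro hausdorff_ample_groupoid.intro hausdorff_ample_groupoid_axioms.intro)
  show ?thesis using spectral_action_B ring_isomorphic_C by blast
qed

end
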